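(* Let $(A,\varphi)$ be a commutative $C^*$-measure space, and let $X$ be a compact Hausdorff space with a regular Borel measure $\mu$ such that $(A,\varphi)\cong(C(X),\varphi_\mu)$ in $\mathbf{QMS}_\sharp$ (the associated Borel measure space). Then for any closed ideal $I$ of $A$ there exists a closed subspace $B$ of $X$ such that $$(A/I,\varphi_I)\cong(C(B),\varphi_{\mu_B})\quad\text{in }\mathbf{QMS}_\sharp,$$ where $\varphi_I$ is the quantum conditional measure on $A/I$ induced from $\varphi$ and $\mu_B$ is the restriction of $\mu$ to the Borel subsets of $B$.
   Context: All measures are finite. A $*$-algebra is a unital $\mathbb{C}$-algebra with a $*$-operation; its positive elements are $A_+=\{a^*a\mid a\in A\}$. A quantum measure space $(A,\varphi)$ is a $*$-algebra $A$ with a $\mathbb{C}$-linear map $\varphi:A\to\mathbb{C}$ such that $\varphi(a)\ge0$ for $a\in A_+$. It is a commutative $C^*$-measure space if $A$ is a commutative unital $C^*$-algebra. $\mathbf{QMS}_\sharp$ is the category of quantum measure spaces whose morphisms $(A,\varphi)\to(A',\varphi')$ are the unital $*$-homomorphisms $f:A\to A'$ that are measure-preserving, i.e. $\varphi'(f(a))=\varphi(a)$ for all $a\in A$. For a compact Hausdorff space $X$ with regular Borel measure $\mu$, $C(X)$ is the $C^*$-algebra of continuous functions $X\to\mathbb{C}$ and $\varphi_\mu(f)=\int_X f\,d\mu$. Similarly $\varphi_{\mu_B}(f)=\int_B f\,d\mu_B$ on $C(B)$. Quantum conditional measure: let $I$ be a two-sided ideal of $A$. Let $N_\varphi=\{a\in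 A\mid\varphi(a^*a)=0\}$, and let $H_\varphi$ be the Hilbert space completion of $A/N_\varphi$ with respect to the inner product $\langle[a]_\varphi,[b]_\varphi\rangle=\varphi(a^*b)$ (the GNS Hilbert space). For $a\in A$ let $a_\varphi\in H_\varphi$ be the image of $a$ under $A\to A/N_\varphi\hookrightarrow H_\varphi$, and let $\xi=e_\varphi$, where $e$ is the unit of $A$. Let $I_\varphi\subset H_\varphi$ be the closure of the image of $I$ under $a\mapsto a_\varphi$, and let $\xi_I^\perp$ be the component of $\xi$ in $I_\varphi^\perp$ in the orthogonal decomposition $H_\varphi=I_\varphi\oplus I_\varphi^\perp$. Then $\varphi_I:A/I\to\mathbb{C}$ is the well-defined positive linear map $\varphi_I[a]=\langle\xi_I^\perp,a_\varphi\rangle$. *)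

theory Defs
  imports "HOL-Analysis.Analysis" "HOL-Algebra.Module" "HOL-Algebra.QuotRing"
begin

section \<open>Unital star-algebras over the complex numbers\<close>

definition complex_ring :: "complex ring" where
  "complex_ring = \<lparr>carrier = UNIV, mult = (*), one = 1, zero = 0, add = (+)\<rparr>"

record 'a star_alg = "(complex, 'a) module" +
  star :: "'a \<Rightarrow> 'a"

text \<open>The locale \<^locale>\<open>algebra\<close> is restricted to commutative algebras, so we start from
  \<^locale>\<open>ring\<close> and \<^locale>\<open>module\<close>. The zero algebra is not excluded.\<close>

locale star_algebra = module complex_ring A + ring A for A :: "('a, 'm) star_alg_scheme" (structure) +
  assumes smult_mult_left:
      "\<lbrakk>x \<in> carrier A; y \<in> carrier A\<rbrakk> \<Longrightarrow> (c \<odot> x) \<otimes> y = c \<odot> (x \<otimes> y)"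
    and smult_mult_right:
      "\<lbrakk>x \<in> carrier A; y \<in> carrier A\<rbrakk> \<Longrightarrow> x \<otimes> (c \<odot> y) = c \<odot> (x \<otimes> y)"
    and star_closed: "x \<in> carrier A \<Longrightarrow> star A x \<in> carrier A"
    and star_add: "\<lbrakk>x \<in> carrier A; y \<in> carrier A\<rbrakk> \<Longrightarrow> star A (x \<oplus> y) = star A x \<oplus> star A y"
    and star_smult: "x \<in> carrier A \<Longrightarrow> star A (c \<odot> x) = cnj c \<odot> star A x"
    and star_mult: "\<lbrakk>x \<in> carrier A; y \<in> carrier A\<rbrakk> \<Longrightarrow> star A (x \<otimes> y) = star A y \<otimes> star A x"
    and star_star: "x \<in> carrier A \<Longrightarrow> star A (star A x) = x"

definition positive_elements :: "('a, 'm) star_alg_scheme \<Rightarrow> 'a set" where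
  "positive_elements A = {star A a \<otimes>\<^bsub>A\<^esub> a | a. a \<in> carrier A}"


section \<open>Quantum measure spaces\<close>

locale quantum_measure_space = star_algebra A for A :: "('a, 'm) star_alg_scheme" (structure) +
  fixes \<phi> :: "'a \<Rightarrow> complex"
  assumes functional_add: "\<lbrakk>x \<in> carrier A; y \<in> carrier A\<rbrakk> \<Longrightarrow> \<phi> (x \<oplus> y) = \<phi> x + \<phi> y"
    and functional_smult: "x \<in> carrier A \<Longrightarrow> \<phi> (c \<odot> x) = c * \<phi> x"
    and functional_positive: "x \<in> positive_elements A \<Longrightarrow> \<phi> x \<in> \<real>\<^sub>\<ge>\<^sub>0"

definition qms_hom ::
  "('a, 'm) star_alg_scheme \<Rightarrow> ('a \<Rightarrow> complex) \<Rightarrow> ('b, 'n) star_alg_scheme \<Rightarrow> ('b \<Rightarrow> complex)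
    \<Rightarrow> ('a \<Rightarrow> 'b) set" where
  "qms_hom A \<phi> A' \<phi>' = {f \<in> ring_hom A A'.
     (\<forall>c. \<forall>a\<in>carrier A. f (c \<odot>\<^bsub>A\<^esub> a) = c \<odot>\<^bsub>A'\<^esub> f a) \<and>
     (\<forall>a\<in>carrier A. f (star A a) = star A' (f a)) \<and>
     (\<forall>a\<in>carrier A. \<phi>' (f a) = \<phi> a)}"

definition qms_isomorphic ::
  "('a, 'm) star_alg_scheme \<Rightarrow> ('a \<Rightarrow> complex) \<Rightarrow> ('b, 'n) star_alg_scheme \<Rightarrow> ('b \<Rightarrow> complex)
    \<Rightarrow> bool" where
  "qms_isomorphic A \<phi> A' \<phi>' \<longleftrightarrow>
     quantum_measure_space A \<phi> \<and> quantum_measure_space A' \<phi>' \<and>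
     (\<exists>f\<in>qms_hom A \<phi> A' \<phi>'. \<exists>g\<in>qms_hom A' \<phi>' A \<phi>.
        (\<forall>a\<in>carrier A. g (f a) = a) \<and> (\<forall>b\<in>carrier A'. f (g b) = b))"


section \<open>C*-algebras\<close>

text \<open>The locale \<^locale>\<open>Metric_space\<close> requires symmetry and nonnegativity of the distance also
  outside the carrier; hence the default value 0 there.\<close>

definition norm_dist :: "('a, 'm) ring_scheme \<Rightarrow> ('a \<Rightarrow> real) \<Rightarrow> 'a \<Rightarrow> 'a \<Rightarrow> real" where
  "norm_dist A nrm x y = (if x \<in> carrier A \<and> y \<in> carrier A then nrm (x \<ominus>\<^bsub>A\<^esub> y) else 0)"

definition norm_topology :: "('a, 'm) ring_scheme \<Rightarrow> ('a \<Rightarrow> real) \<Rightarrow> 'a topology" where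
  "norm_topology A nrm = Metric_space.mtopology (carrier A) (norm_dist A nrm)"

locale c_star_algebra = star_algebra A for A :: "('a, 'm) star_alg_scheme" (structure) +
  fixes nrm :: "'a \<Rightarrow> real"
  assumes nrm_nonneg: "x \<in> carrier A \<Longrightarrow> 0 \<le> nrm x"
    and nrm_eq_0_iff: "x \<in> carrier A \<Longrightarrow> nrm x = 0 \<longleftrightarrow> x = \<zero>"
    and nrm_triangle: "\<lbrakk>x \<in> carrier A; y \<in> carrier A\<rbrakk> \<Longrightarrow> nrm (x \<oplus> y) \<le> nrm x + nrm y"
    and nrm_smult: "x \<in> carrier A \<Longrightarrow> nrm (c \<odot> x) = cmod c * nrm x"
    and nrm_mult: "\<lbrakk>x \<in> carrier A; y \<in> carrier A\<rbrakk> \<Longrightarrow> nrm (x \<otimes> y) \<le> nrm x * nrm y"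
    and nrm_star_mult: "x \<in> carrier A \<Longrightarrow> nrm (star A x \<otimes> x) = (nrm x)\<^sup>2"
    and nrm_complete: "Metric_space.mcomplete (carrier A) (norm_dist A nrm)"

lemma (in c_star_algebra) Metric_space_norm_dist: "Metric_space (carrier A) (norm_dist A nrm)"
proof
  fix x y z
  have uminus: "nrm (\<ominus> x) = nrm x" if "x \<in> carrier A" for x
  proof -
    have "(-1) \<odot> x \<oplus> x = ((-1) \<oplus>\<^bsub>complex_ring\<^esub> 1) \<odot> x"
      using that smult_l_distr[of "-1" 1 x] smult_one[of x] by (simp add: complex_ring_def)
    also have "\<dots> = \<zero>\<^bsub>complex_ring\<^esub> \<odot> x"
      by (simp add: complex_ring_def)
    also have "\<dots> = \<zero>"
      using that by (rule smult_l_null)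
    finally have "(-1) \<odot> x \<oplus> x = \<zero>" .
    moreover have "(-1) \<odot> x \<in> carrier A"
      using that smult_closed[of "-1" x] by (simp add: complex_ring_def)
    ultimately have "\<ominus> x = (-1) \<odot> x"
      using that minus_equality by blast
    then show ?thesis
      using that nrm_smult[of x "-1"] by simp
  qed
  show "0 \<le> norm_dist A nrm x y"
    by (simp add: norm_dist_def nrm_nonneg)
  show "norm_dist A nrm x y = norm_dist A nrm y x"
  proof -
    have "nrm (x \<ominus> y) = nrm (y \<ominus> x)" if "x \<in> carrier A" "y \<in> carrier A"
    proof -
      have "y \<ominus> x = \<ominus> (x \<ominus> y)"
        using that by (simp add: a_minus_def minus_add a_comm)
      with that uminus[of "x \<ominus> y"] show ?thesis by simp
    qed
    then show ?thesis by (auto simp: norm_dist_def)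
  qed
  show "norm_dist A nrm x y = 0 \<longleftrightarrow> x = y" if "x \<in> carrier A" "y \<in> carrier A"
    proof -
    have "x \<ominus> y = \<zero> \<longleftrightarrow> x = y"
      using that by (metis a_minus_def add.inv_closed minus_equality minus_minus r_neg)
    with that show ?thesis by (simp add: norm_dist_def nrm_eq_0_iff)
  qed
  show "norm_dist A nrm x z \<le> norm_dist A nrm x y + norm_dist A nrm y z"
    if "x \<in> carrier A" "y \<in> carrier A" "z \<in> carrier A"
  proof -
    have "x \<ominus> z = (x \<ominus> y) \<oplus> (y \<ominus> z)"
      using that by (simp add: a_minus_def a_assoc r_neg1)
    with that show ?thesis
      using nrm_triangle[of "x \<ominus> y" "y \<ominus> z"] by (simp add: norm_dist_def)
  qed
qed

locale commutative_c_star_measure_space =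
  c_star_algebra A nrm + cring A + quantum_measure_space A \<phi>
  for A :: "('a, 'm) star_alg_scheme" (structure) and nrm \<phi>


section \<open>Quotients by ideals\<close>

definition coset_smult ::
  "('a, 'm) star_alg_scheme \<Rightarrow> 'a set \<Rightarrow> complex \<Rightarrow> 'a set \<Rightarrow> 'a set" where
  "coset_smult A I c C = (\<Union>a\<in>C. I +>\<^bsub>A\<^esub> (c \<odot>\<^bsub>A\<^esub> a))"

definition coset_star :: "('a, 'm) star_alg_scheme \<Rightarrow> 'a set \<Rightarrow> 'a set \<Rightarrow> 'a set" where
  "coset_star A I C = (\<Union>a\<in>C. I +>\<^bsub>A\<^esub> star A a)"

definition quotient_star_alg :: "('a, 'm) star_alg_scheme \<Rightarrow> 'a set \<Rightarrow> 'a set star_alg" where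
  "quotient_star_alg A I =
    \<lparr>carrier = carrier (A Quot I), mult = mult (A Quot I), one = one (A Quot I),
     zero = zero (A Quot I), add = add (A Quot I),
     smult = coset_smult A I, star = coset_star A I\<rparr>"


section \<open>Complex inner product spaces and their completion\<close>

text \<open>In the records below the fields \<open>mult\<close> and \<open>one\<close>, which \<open>module\<close> inherits from \<open>ring\<close>,
  are irrelevant. Inner products are conjugate-linear in the first argument.\<close>

record 'v cinner_space = "(complex, 'v) module" +
  cinner :: "'v \<Rightarrow> 'v \<Rightarrow> complex"

definition cinner_dist :: "('v, 'm) cinner_space_scheme \<Rightarrow> 'v \<Rightarrow> 'v \<Rightarrow> real" where
  "cinner_dist V = norm_dist V (\<lambda>x. sqrt (Re (cinner V x x)))"

definition cinner_topology :: "('v, 'm) cinner_space_scheme \<Rightarrow> 'v topology" where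
  "cinner_topology V = Metric_space.mtopology (carrier V) (cinner_dist V)"

definition cauchy_seqs :: "('v, 'm) cinner_space_scheme \<Rightarrow> (nat \<Rightarrow> 'v) set" where
  "cauchy_seqs V = {s. Metric_space.MCauchy (carrier V) (cinner_dist V) s}"

definition cauchy_rel :: "('v, 'm) cinner_space_scheme \<Rightarrow> ((nat \<Rightarrow> 'v) \<times> (nat \<Rightarrow> 'v)) set" where
  "cauchy_rel V = {(s, t). s \<in> cauchy_seqs V \<and> t \<in> cauchy_seqs V \<and>
     (\<lambda>n. cinner_dist V (s n) (t n)) \<longlonglongrightarrow> 0}"

definition completion ::
  "('v, 'm) cinner_space_scheme \<Rightarrow> (nat \<Rightarrow> 'v) set cinner_space" where
  "completion V =
    \<lparr>carrier = cauchy_seqs V // cauchy_rel V,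
     mult = undefined,
     one = undefined,
     zero = cauchy_rel V `` {\<lambda>n. \<zero>\<^bsub>V\<^esub>},
     add = (\<lambda>S T. \<Union>s\<in>S. \<Union>t\<in>T. cauchy_rel V `` {\<lambda>n. s n \<oplus>\<^bsub>V\<^esub> t n}),
     smult = (\<lambda>c S. \<Union>s\<in>S. cauchy_rel V `` {\<lambda>n. c \<odot>\<^bsub>V\<^esub> s n}),
     cinner = (\<lambda>S T. lim (\<lambda>n. cinner V ((SOME s. s \<in> S) n) ((SOME t. t \<in> T) n)))\<rparr>"

definition completion_embed :: "('v, 'm) cinner_space_scheme \<Rightarrow> 'v \<Rightarrow> (nat \<Rightarrow> 'v) set" where
  "completion_embed V v = cauchy_rel V `` {\<lambda>n. v}"

definition orth_complement :: "('v, 'm) cinner_space_scheme \<Rightarrow> 'v set \<Rightarrow> 'v set" where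
  "orth_complement H K = {x \<in> carrier H. \<forall>y\<in>K. cinner H y x = 0}"

text \<open>The component in \<open>orth_complement H K\<close> of \<open>v\<close>, for a closed subspace \<open>K\<close> of a
  Hilbert space \<open>H\<close>.\<close>

definition orth_component :: "('v, 'm) cinner_space_scheme \<Rightarrow> 'v set \<Rightarrow> 'v \<Rightarrow> 'v" where
  "orth_component H K v = (THE y. y \<in> orth_complement H K \<and> (\<exists>x\<in>K. v = x \<oplus>\<^bsub>H\<^esub> y))"


section \<open>The GNS Hilbert space and the quantum conditional measure\<close>

definition gns_null :: "('a, 'm) star_alg_scheme \<Rightarrow> ('a \<Rightarrow> complex) \<Rightarrow> 'a set" where
  "gns_null A \<phi> = {a \<in> carrier A. \<phi> (star A a \<otimes>\<^bsub>A\<^esub> a) = 0}"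

definition gns_quotient ::
  "('a, 'm) star_alg_scheme \<Rightarrow> ('a \<Rightarrow> complex) \<Rightarrow> 'a set cinner_space" where
  "gns_quotient A \<phi> =
    \<lparr>carrier = a_rcosets\<^bsub>A\<^esub> (gns_null A \<phi>),
     mult = undefined,
     one = undefined,
     zero = gns_null A \<phi>,
     add = set_add A,
     smult = coset_smult A (gns_null A \<phi>),
     cinner = (\<lambda>C D. \<phi> (star A (SOME a. a \<in> C) \<otimes>\<^bsub>A\<^esub> (SOME b. b \<in> D)))\<rparr>"

definition gns_space ::
  "('a, 'm) star_alg_scheme \<Rightarrow> ('a \<Rightarrow> complex) \<Rightarrow> (nat \<Rightarrow> 'a set) set cinner_space" where
  "gns_space A \<phi> = completion (gns_quotient A \<phi>)"

definition gns_vec ::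
  "('a, 'm) star_alg_scheme \<Rightarrow> ('a \<Rightarrow> complex) \<Rightarrow> 'a \<Rightarrow> (nat \<Rightarrow> 'a set) set" where
  "gns_vec A \<phi> a = completion_embed (gns_quotient A \<phi>) (gns_null A \<phi> +>\<^bsub>A\<^esub> a)"

definition gns_ideal ::
  "('a, 'm) star_alg_scheme \<Rightarrow> ('a \<Rightarrow> complex) \<Rightarrow> 'a set \<Rightarrow> (nat \<Rightarrow> 'a set) set set" where
  "gns_ideal A \<phi> I = cinner_topology (gns_space A \<phi>) closure_of (gns_vec A \<phi> ` I)"

definition conditional_measure ::
  "('a, 'm) star_alg_scheme \<Rightarrow> ('a \<Rightarrow> complex) \<Rightarrow> 'a set \<Rightarrow> 'a set \<Rightarrow> complex" where
  "conditional_measure A \<phi> I C =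
     cinner (gns_space A \<phi>)
       (orth_component (gns_space A \<phi>) (gns_ideal A \<phi> I) (gns_vec A \<phi> \<one>\<^bsub>A\<^esub>))
       (gns_vec A \<phi> (SOME a. a \<in> C))"


section \<open>Continuous functions and regular Borel measures\<close>

text \<open>Functions on \<open>topspace X\<close> are represented by extensional functions on the ambient type.\<close>

definition continuous_functions :: "'x topology \<Rightarrow> ('x \<Rightarrow> complex) star_alg" where
  "continuous_functions X =
    \<lparr>carrier = {f \<in> extensional (topspace X). continuous_map X euclidean f},
     mult = (\<lambda>f g. \<lambda>x\<in>topspace X. f x * g x),
     one = (\<lambda>x\<in>topspace X. 1),
     zero = (\<lambda>x\<in>topspace X. 0),
     add = (\<lambda>f g. \<lambda>x\<in>topspace X. f x + g x),
     smult = (\<lambda>c f. \<lambda>x\<in>topspace X. c * f x),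
     star = (\<lambda>f. \<lambda>x\<in>topspace X. cnj (f x))\<rparr>"

definition integral_functional :: "'x measure \<Rightarrow> ('x \<Rightarrow> complex) \<Rightarrow> complex" where
  "integral_functional M f = (\<integral>x. f x \<partial>M)"

locale regular_borel_measure = finite_measure M for M :: "'x measure" +
  fixes X :: "'x topology"
  assumes space_eq: "space M = topspace X"
    and sets_eq: "sets M = sigma_sets (topspace X) {U. openin X U}"
    and outer_regular:
      "E \<in> sets M \<Longrightarrow> emeasure M E = (INF U\<in>{U. openin X U \<and> E \<subseteq> U}. emeasure M U)"
    and inner_regular:
      "E \<in> sets M \<Longrightarrow> emeasure M E = (SUP K\<in>{K. compactin X K \<and> closedin X K \<and> K \<subseteq> E}. emeasure M K)"

end

theory Submission
  imports Defs
begin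

text \<open>Under \<open>A \<cong> C(X)\<close> the ideal \<open>I\<close> becomes the ideal of functions vanishing on a closed set \<open>B\<close>.
  This uses that the image of \<open>I\<close> is closed for the supremum norm: a real function with
  values in \<open>[-1, 1]\<close> is the mean of two unitaries, so the norm transported from \<open>A\<close> is at most
  twice the supremum norm. Restriction to \<open>B\<close> then induces \<open>A/I \<cong> C(B)\<close>, surjectively by
  Tietze's theorem. For the functionals, outer regularity and Urysohn's lemma give continuous
  \<open>u\<^sub>n\<close> with values in \<open>[0, 1]\<close> and \<open>u\<^sub>n = 1\<close> on \<open>B\<close> that converge in \<open>L\<^sup>2\<close> to the indicator function
  of \<open>B\<close>. Since \<open>1 - u\<^sub>n\<close> lies in \<open>I\<close> and the limit is orthogonal to \<open>I\<close>, the limit is \<open>\<xi>\<^sub>I\<^sup>\<bottom>\<close>,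
  and pairing it with \<open>a\<close> integrates \<open>a\<close> over \<open>B\<close>.\<close>

section \<open>The complex numbers as a ring\<close>

text \<open>The isomorphism with \<open>C(X)\<close> respects the algebra, the star and the
  functional, but nothing links \<open>nrm\<close> to the supremum norm. Closedness of
  \<open>I\<close> is a statement about \<open>nrm\<close>, so the passage from uniform
  approximation to approximation in \<open>nrm\<close> has to come out of the algebra. Unitaries
  provide it, because the C*-identity alone bounds their norm. Elements of the GNS space are classes
  of Cauchy sequences of cosets, so a sequence in \<open>A\<close> is itself a vector: the classes
  of \<open>1 - u_n\<close> and of \<open>u_n\<close> exhibit the orthogonal decomposition of the
  unit vector explicitly. Square convergence is obtained from convergence in mean, since the
  \<open>u_n\<close> take values in [0, 1]. Dividing by null vectors and dividing by null sequences
  are the same step, a semidefinite form divided by its kernel, so it is carried out once for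
  semi-inner products. Representatives picked by \<open>SOME\<close> are harmless, because the form
  does not see null vectors.\<close>

lemma complex_ring_simps [simp]:
  "carrier complex_ring = UNIV" "mult complex_ring = (*)" "one complex_ring = 1"
  "zero complex_ring = 0" "add complex_ring = (+)"
  by (simp_all add: complex_ring_def)

lemma cring_complex_ring: "cring complex_ring"
proof (rule cringI)
  show "abelian_group complex_ring"
  proof (rule abelian_groupI)
    show "\<exists>y\<in>carrier complex_ring. y \<oplus>\<^bsub>complex_ring\<^esub> x = \<zero>\<^bsub>complex_ring\<^esub>" for x
      by (auto intro!: exI[of _ "- x"])
  qed auto
  show "comm_monoid complex_ring"
    by (rule comm_monoidI) auto
qed (auto simp: algebra_simps)

lemma complex_ring_a_inv [simp]: "\<ominus>\<^bsub>complex_ring\<^esub> c = - c"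
proof -
  interpret cring complex_ring by (rule cring_complex_ring)
  show ?thesis using minus_equality[of "- c" c] by simp
qed

section \<open>Semi-inner products\<close>

text \<open>Definiteness is left out so that the locale covers a form before its null vectors are
  divided out: \<open>A\<close> with \<open>\<phi> (star A a \<otimes> b)\<close>, and the Cauchy
  sequences with the limit form. The form is a separate parameter because \<open>A\<close> has no
  \<open>cinner\<close> field. Conjugate symmetry follows from positivity, see
  \<open>ip_commute\<close>.\<close>

locale semi_inner_product = module complex_ring V
  for V :: "(complex, 'v, 'm) module_scheme" (structure) +
  fixes ip :: "'v \<Rightarrow> 'v \<Rightarrow> complex"
  assumes ip_add_left:
      "\<lbrakk>x \<in> carrier V; y \<in> carrier V; z \<in> carrier V\<rbrakk> \<Longrightarrow> ip (x \<oplus> y) z = ip x z + ip y z"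
    and ip_add_right:
      "\<lbrakk>x \<in> carrier V; y \<in> carrier V; z \<in> carrier V\<rbrakk> \<Longrightarrow> ip x (y \<oplus> z) = ip x y + ip x z"
    and ip_smult_left: "\<lbrakk>x \<in> carrier V; y \<in> carrier V\<rbrakk> \<Longrightarrow> ip (c \<odot> x) y = cnj c * ip x y"
    and ip_smult_right: "\<lbrakk>x \<in> carrier V; y \<in> carrier V\<rbrakk> \<Longrightarrow> ip x (c \<odot> y) = c * ip x y"
    and ip_nonneg: "x \<in> carrier V \<Longrightarrow> ip x x \<in> \<real>\<^sub>\<ge>\<^sub>0"
begin

definition seminorm :: "'v \<Rightarrow> real" where
  "seminorm x = sqrt (Re (ip x x))"

lemma smult_in [simp, intro]: "x \<in> carrier V \<Longrightarrow> c \<odot> x \<in> carrier V"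
  using smult_closed[of c x] by simp

lemma minus_eq_smult: "x \<in> carrier V \<Longrightarrow> \<ominus> x = (-1) \<odot> x"
  using smult_l_minus[of 1 x] smult_one[of x] by simp

lemma ip_zero_left: "x \<in> carrier V \<Longrightarrow> ip \<zero> x = 0"
  using ip_add_left[of \<zero> \<zero> x] by simp

lemma ip_minus_left:
  "\<lbrakk>x \<in> carrier V; y \<in> carrier V; z \<in> carrier V\<rbrakk> \<Longrightarrow> ip (x \<ominus> y) z = ip x z - ip y z"
  by (simp add: a_minus_def minus_eq_smult ip_add_left ip_smult_left)

lemma ip_minus_right:
  "\<lbrakk>x \<in> carrier V; y \<in> carrier V; z \<in> carrier V\<rbrakk> \<Longrightarrow> ip x (y \<ominus> z) = ip x y - ip x z"
  by (simp add: a_minus_def minus_eq_smult ip_add_right ip_smult_right)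

lemma ip_self: "x \<in> carrier V \<Longrightarrow> ip x x = (complex_of_real (seminorm x))\<^sup>2"
  using ip_nonneg[of x] by (simp add: seminorm_def complex_nonneg_Reals_iff complex_eq_iff)

lemma seminorm_nonneg [simp]: "x \<in> carrier V \<Longrightarrow> 0 \<le> seminorm x"
  using ip_nonneg[of x] by (simp add: seminorm_def complex_nonneg_Reals_iff)

text \<open>Polarization: the form is real on \<open>x \<oplus> y\<close> and on
  \<open>x \<oplus> \<i> \<odot> y\<close>. The first expansion gives opposite imaginary parts, the
  second equal real parts.\<close>

lemma ip_commute:
  assumes "x \<in> carrier V" "y \<in> carrier V"
  shows "ip y x = cnj (ip x y)"
proof -
  have Im: "Im (ip z z) = 0" if "z \<in> carrier V" for z
    using ip_nonneg[OF that] by (simp add: complex_nonneg_Reals_iff)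
  have "Im (ip (x \<oplus> y) (x \<oplus> y)) = 0" "Im (ip (x \<oplus> \<i> \<odot> y) (x \<oplus> \<i> \<odot> y)) = 0"
    using assms by (auto intro: Im)
  then have "Im (ip x y) + Im (ip y x) = 0" "Re (ip x y) = Re (ip y x)"
    using assms Im by (auto simp: ip_add_left ip_add_right ip_smult_left ip_smult_right)
  then show ?thesis by (simp add: complex_eq_iff)
qed

text \<open>Positivity at \<open>x \<oplus> c \<odot> y\<close> with \<open>c = - t * cnj z\<close>
  gives a real polynomial in \<open>t\<close> that is never negative. If the bound failed, a
  suitable \<open>t\<close> would make it negative.\<close>

lemma cauchy_schwarz:
  assumes "x \<in> carrier V" "y \<in> carrier V"
  shows "cmod (ip x y) \<le> seminorm x * seminorm y"
proof (rule ccontr)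
  define z where "z = ip x y"
  define a where "a = (seminorm x)\<^sup>2"
  define b where "b = (seminorm y)\<^sup>2"
  assume "\<not> ?thesis"
  then have less: "seminorm x * seminorm y < cmod z" by (simp add: z_def)
  moreover have "0 \<le> seminorm x * seminorm y" using assms by simp
  ultimately have z: "0 < (cmod z)\<^sup>2" and ab: "a * b < (cmod z)\<^sup>2"
    unfolding a_def b_def power_mult_distrib[symmetric] by (auto intro: power_strict_mono)
  have pos: "0 \<le> a - 2 * t * (cmod z)\<^sup>2 + t\<^sup>2 * (cmod z)\<^sup>2 * b" for t :: real
  proof -
    define c where "c = - complex_of_real t * cnj z"
    have "ip (x \<oplus> c \<odot> y) (x \<oplus> c \<odot> y) = ip x x + c * z + cnj c * cnj z + cnj c * c * ip y y"
      using assms by (simp add: ip_add_left ip_add_right ip_smult_left ip_smult_right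
          ip_commute[of x y] z_def algebra_simps)
    also have "\<dots> = complex_of_real (a - 2 * t * (cmod z)\<^sup>2 + t\<^sup>2 * (cmod z)\<^sup>2 * b)"
      using assms by (simp add: c_def ip_self a_def b_def complex_norm_square[of z, unfolded of_real_power]
          power2_eq_square[of t] algebra_simps)
    finally show ?thesis
      using ip_nonneg[of "x \<oplus> c \<odot> y"] assms by (simp add: complex_nonneg_Reals_iff)
  qed
  have "0 \<le> b" by (simp add: b_def)
  show False
  proof (cases "b = 0")
    case True
    \<comment> \<open>For a null vector \<open>y\<close> the polynomial is affine in
      \<open>t\<close>, and this \<open>t\<close> gives it the value -1.\<close>
    with pos[of "(a + 1) / (2 * (cmod z)\<^sup>2)"] z show False by simp
  next
    case False
    with \<open>0 \<le> b\<close> have "0 < b" by simp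
    \<comment> \<open>At \<open>t = 1 / b\<close> the polynomial attains its minimum,
      \<open>a\<close> minus the square of \<open>cmod z\<close> divided by
      \<open>b\<close>.\<close>
    then show False
      using pos[of "1 / b"] ab by (simp add: field_simps power2_eq_square)
  qed
qed

lemma seminorm_triangle:
  assumes "x \<in> carrier V" "y \<in> carrier V"
  shows "seminorm (x \<oplus> y) \<le> seminorm x + seminorm y"
proof -
  have "complex_of_real ((seminorm (x \<oplus> y))\<^sup>2) = ip x x + ip x y + cnj (ip x y) + ip y y"
    using assms by (simp add: ip_self[symmetric] ip_add_left ip_add_right ip_commute[of x y])
  then have "(seminorm (x \<oplus> y))\<^sup>2 = (seminorm x)\<^sup>2 + 2 * Re (ip x y) + (seminorm y)\<^sup>2"
    using assms by (simp add: ip_self complex_eq_iff)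
  also have "\<dots> \<le> (seminorm x + seminorm y)\<^sup>2"
    using cauchy_schwarz[OF assms] complex_Re_le_cmod[of "ip x y"]
    by (simp add: power2_sum)
  finally show ?thesis
    by (rule power2_le_imp_le) (use assms in simp)
qed

lemma seminorm_smult: "x \<in> carrier V \<Longrightarrow> seminorm (c \<odot> x) = cmod c * seminorm x"
proof -
  assume x: "x \<in> carrier V"
  have "complex_of_real ((seminorm (c \<odot> x))\<^sup>2) = of_real ((cmod c)\<^sup>2) * ip x x"
    using x by (simp add: ip_self[symmetric] ip_smult_left ip_smult_right
        complex_norm_square[of c, unfolded of_real_power])
  also have "\<dots> = complex_of_real ((cmod c * seminorm x)\<^sup>2)"
    using x by (simp add: ip_self power_mult_distrib)
  finally have "(seminorm (c \<odot> x))\<^sup>2 = (cmod c * seminorm x)\<^sup>2"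
    using of_real_eq_iff by blast
  then show ?thesis using x by (simp add: power2_eq_iff_nonneg)
qed

lemma seminorm_zero [simp]: "seminorm \<zero> = 0"
  by (simp add: seminorm_def ip_zero_left)

lemma seminorm_minus: "x \<in> carrier V \<Longrightarrow> seminorm (\<ominus> x) = seminorm x"
  by (simp add: minus_eq_smult seminorm_smult)

lemma diff_self [simp]: "x \<in> carrier V \<Longrightarrow> x \<ominus> x = \<zero>"
  by (simp add: a_minus_def r_neg)

lemma diff_eq_zero_iff: "\<lbrakk>x \<in> carrier V; y \<in> carrier V\<rbrakk> \<Longrightarrow> x \<ominus> y = \<zero> \<longleftrightarrow> x = y"
  by (metis a_minus_def add.inv_closed diff_self minus_equality minus_minus)

lemma minus_zero_right: "x \<in> carrier V \<Longrightarrow> x \<ominus> \<zero> = x"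
  by (simp add: a_minus_def minus_equality)

lemma seminorm_diff_commute:
  "\<lbrakk>x \<in> carrier V; y \<in> carrier V\<rbrakk> \<Longrightarrow> seminorm (x \<ominus> y) = seminorm (y \<ominus> x)"
  using seminorm_minus[of "x \<ominus> y"] by (simp add: a_minus_def minus_add a_comm)

lemma seminorm_diff_triangle:
  assumes "x \<in> carrier V" "y \<in> carrier V" "z \<in> carrier V"
  shows "seminorm (x \<ominus> z) \<le> seminorm (x \<ominus> y) + seminorm (y \<ominus> z)"
proof -
  have "x \<ominus> z = (x \<ominus> y) \<oplus> (y \<ominus> z)"
    using assms by (simp add: a_minus_def a_assoc r_neg1)
  then show ?thesis using assms seminorm_triangle[of "x \<ominus> y" "y \<ominus> z"] by simp
qed

lemma add_diff_add:
  assumes "x \<in> carrier V" "y \<in> carrier V" "x' \<in> carrier V" "y' \<in> carrier V"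
  shows "(x \<oplus> y) \<ominus> (x' \<oplus> y') = (x \<ominus> x') \<oplus> (y \<ominus> y')"
  using assms by (simp add: a_minus_def minus_add a_ac)

lemma smult_diff:
  assumes "x \<in> carrier V" "y \<in> carrier V"
  shows "c \<odot> x \<ominus> c \<odot> y = c \<odot> (x \<ominus> y)"
  using assms smult_r_distr[of c x "\<ominus> y"] smult_r_minus[of c y] by (simp add: a_minus_def)

lemma seminorm_diff_add:
  assumes "x \<in> carrier V" "y \<in> carrier V" "x' \<in> carrier V" "y' \<in> carrier V"
  shows "seminorm ((x \<oplus> y) \<ominus> (x' \<oplus> y')) \<le> seminorm (x \<ominus> x') + seminorm (y \<ominus> y')"
  using assms by (simp add: add_diff_add seminorm_triangle)

lemma seminorm_le_diff:
  assumes "x \<in> carrier V" "y \<in> carrier V"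
  shows "seminorm x \<le> seminorm y + seminorm (x \<ominus> y)"
proof -
  have "x = y \<oplus> (x \<ominus> y)"
    using assms by (simp add: a_minus_def a_lcomm r_neg)
  then show ?thesis using assms seminorm_triangle[of y "x \<ominus> y"] by simp
qed

text \<open>One argument is changed at a time, with Cauchy-Schwarz for each change. This estimate
  yields both the independence of representatives (\<open>ip_null\<close>) and the convergence of
  inner products along Cauchy sequences.\<close>

lemma ip_diff_bound:
  assumes "x \<in> carrier V" "y \<in> carrier V" "x' \<in> carrier V" "y' \<in> carrier V"
  shows "cmod (ip x y - ip x' y') \<le> seminorm x * seminorm (y \<ominus> y') + seminorm (x \<ominus> x') * seminorm y'"
proof -
  have "ip x y - ip x' y' = ip x (y \<ominus> y') + ip (x \<ominus> x') y'"
    using assms by (simp add: ip_minus_left ip_minus_right)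
  then show ?thesis
    using assms cauchy_schwarz[of x "y \<ominus> y'"] cauchy_schwarz[of "x \<ominus> x'" y']
      norm_triangle_ineq[of "ip x (y \<ominus> y')" "ip (x \<ominus> x') y'"]
    by simp
qed

text \<open>Allows the \<open>SOME\<close> representatives in the inner products of
  \<open>gns_quotient\<close> and \<open>completion\<close> to be exchanged for any others.\<close>

lemma ip_null:
  assumes "x \<in> carrier V" "y \<in> carrier V" "x' \<in> carrier V" "y' \<in> carrier V"
    and "seminorm (x \<ominus> x') = 0" "seminorm (y \<ominus> y') = 0"
  shows "ip x y = ip x' y'"
  using ip_diff_bound[OF assms(1-4)] assms(5,6) by simp

end

locale pre_hilbert = semi_inner_product V "cinner V"
  for V :: "('v, 'm) cinner_space_scheme" (structure) +
  assumes definite: "\<lbrakk>x \<in> carrier V; cinner V x x = 0\<rbrakk> \<Longrightarrow> x = \<zero>"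

text \<open>All laws of \<open>W\<close> are pulled through \<open>q\<close> from \<open>V\<close>;
  only definiteness is new, and \<open>null\<close> supplies it. It is applied with \<open>q\<close>
  sending \<open>a\<close> to its coset modulo \<open>gns_null\<close>, and with \<open>q\<close>
  sending a Cauchy sequence to its class.\<close>

lemma (in semi_inner_product) pre_hilbert_quotient:
  fixes W :: "('w, 'n) cinner_space_scheme" and q :: "'v \<Rightarrow> 'w"
  assumes W: "carrier W = q ` carrier V"
    and zero: "q \<zero> = \<zero>\<^bsub>W\<^esub>"
    and add: "\<And>x y. \<lbrakk>x \<in> carrier V; y \<in> carrier V\<rbrakk> \<Longrightarrow> q x \<oplus>\<^bsub>W\<^esub> q y = q (x \<oplus> y)"
    and smult: "\<And>c x. x \<in> carrier V \<Longrightarrow> c \<odot>\<^bsub>W\<^esub> q x = q (c \<odot> x)"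
    and cinner: "\<And>x y. \<lbrakk>x \<in> carrier V; y \<in> carrier V\<rbrakk> \<Longrightarrow> cinner W (q x) (q y) = ip x y"
    and null: "\<And>x. \<lbrakk>x \<in> carrier V; ip x x = 0\<rbrakk> \<Longrightarrow> q x = \<zero>\<^bsub>W\<^esub>"
  shows "pre_hilbert W"
proof -
  have "abelian_group W"
  proof (rule abelian_groupI)
    fix a assume "a \<in> carrier W"
    then obtain x where "x \<in> carrier V" "a = q x" using W by auto
    then show "\<exists>b\<in>carrier W. b \<oplus>\<^bsub>W\<^esub> a = \<zero>\<^bsub>W\<^esub>"
      using W zero by (intro bexI[of _ "q (\<ominus> x)"]) (auto simp: add l_neg)
  qed (use W zero in \<open>auto simp: add a_ac zero[symmetric]\<close>)
  then have "module complex_ring W"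
  proof (rule moduleI[OF cring_complex_ring])
    fix a b :: complex and x
    assume "x \<in> carrier W"
    then show "(a \<oplus>\<^bsub>complex_ring\<^esub> b) \<odot>\<^bsub>W\<^esub> x = a \<odot>\<^bsub>W\<^esub> x \<oplus>\<^bsub>W\<^esub> b \<odot>\<^bsub>W\<^esub> x"
      using smult_l_distr[of a b] by (auto simp: W add smult)
  next
    fix a b :: complex and x
    assume "x \<in> carrier W"
    then show "(a \<otimes>\<^bsub>complex_ring\<^esub> b) \<odot>\<^bsub>W\<^esub> x = a \<odot>\<^bsub>W\<^esub> (b \<odot>\<^bsub>W\<^esub> x)"
      using smult_assoc1[of a b] by (auto simp: W add smult)
  next
    fix a :: complex and x y
    assume "x \<in> carrier W" "y \<in> carrier W"
    then show "a \<odot>\<^bsub>W\<^esub> (x \<oplus>\<^bsub>W\<^esub> y) = a \<odot>\<^bsub>W\<^esub> x \<oplus>\<^bsub>W\<^esub> a \<odot>\<^bsub>W\<^esub> y"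
      using smult_r_distr[of a] by (auto simp: W add smult)
  qed (use smult_one in \<open>auto simp: W smult\<close>)
  then show ?thesis
  proof (intro pre_hilbert.intro semi_inner_product.intro semi_inner_product_axioms.intro
      pre_hilbert_axioms.intro)
  qed (auto simp: W add smult cinner ip_add_left ip_add_right ip_smult_left ip_smult_right
      ip_nonneg null)
qed

context pre_hilbert
begin

lemma seminorm_eq_0_iff: "x \<in> carrier V \<Longrightarrow> seminorm x = 0 \<longleftrightarrow> x = \<zero>"
  using definite[of x] by (auto simp: ip_self)

lemma cinner_dist_eq:
  "\<lbrakk>x \<in> carrier V; y \<in> carrier V\<rbrakk> \<Longrightarrow> cinner_dist V x y = seminorm (x \<ominus> y)"
  by (simp add: cinner_dist_def norm_dist_def seminorm_def)

lemma Metric_space_cinner_dist: "Metric_space (carrier V) (cinner_dist V)"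
proof
  fix x y z
  show "0 \<le> cinner_dist V x y"
    using seminorm_nonneg[of "x \<ominus> y"] by (auto simp: cinner_dist_def norm_dist_def seminorm_def)
  show "cinner_dist V x y = cinner_dist V y x"
    using seminorm_diff_commute[of x y] by (auto simp: cinner_dist_def norm_dist_def seminorm_def)
  show "cinner_dist V x y = 0 \<longleftrightarrow> x = y" if "x \<in> carrier V" "y \<in> carrier V"
    using that seminorm_eq_0_iff[of "x \<ominus> y"] diff_eq_zero_iff by (simp add: cinner_dist_eq)
  show "cinner_dist V x z \<le> cinner_dist V x y + cinner_dist V y z"
    if "x \<in> carrier V" "y \<in> carrier V" "z \<in> carrier V"
    using that seminorm_diff_triangle[of x y z] by (simp add: cinner_dist_eq)
qed

text \<open>Continuity of the form in its first argument: for \<open>z\<close> in \<open>S\<close>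
  close to \<open>x\<close>, the inner product of \<open>x\<close> with \<open>y\<close> equals that
  of \<open>x \<ominus> z\<close> with \<open>y\<close>, which is small.\<close>

lemma orth_complement_closure:
  assumes "y \<in> carrier V" "S \<subseteq> carrier V" "\<And>x. x \<in> S \<Longrightarrow> cinner V x y = 0"
  shows "y \<in> orth_complement V (cinner_topology V closure_of S)"
proof -
  interpret M: Metric_space "carrier V" "cinner_dist V" by (rule Metric_space_cinner_dist)
  have "cinner V x y = 0" if x: "x \<in> cinner_topology V closure_of S" for x
  proof -
    have "cmod (cinner V x y) \<le> 0 + e" if "0 < e" for e
    proof -
      \<comment> \<open>Adding 1 keeps the radius \<open>e / (seminorm y + 1)\<close> positive also
        for \<open>y = \<zero>\<close>.\<close>
      have pos: "0 < seminorm y + 1"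
        using seminorm_nonneg[OF assms(1)] by simp
      then obtain z where z: "z \<in> S" "z \<in> M.mball x (e / (seminorm y + 1))"
        using x \<open>0 < e\<close> unfolding cinner_topology_def M.metric_closure_of
        by simp (metis divide_pos_pos M.in_mball)
      then have V: "x \<in> carrier V" "z \<in> carrier V"
        and "seminorm (x \<ominus> z) \<le> e / (seminorm y + 1)"
        using assms(2) by (auto simp: cinner_dist_eq)
      then have "seminorm (x \<ominus> z) * seminorm y \<le> e / (seminorm y + 1) * (seminorm y + 1)"
        using assms(1) \<open>0 < e\<close> by (intro mult_mono) auto
      moreover have "cinner V x y = cinner V (x \<ominus> z) y"
        using V assms(1) assms(3)[OF z(1)] by (simp add: ip_minus_left)
      ultimately show ?thesis
        using V assms(1) cauchy_schwarz[of "x \<ominus> z" y] pos by simp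
    qed
    then have "cmod (cinner V x y) \<le> 0" by (rule field_le_epsilon)
    then show ?thesis by simp
  qed
  with assms(1) show ?thesis by (simp add: orth_complement_def)
qed

text \<open>The point is uniqueness for the \<open>THE\<close>. Pairing two decompositions with
  \<open>y\<close> and with \<open>y'\<close> removes their parts in \<open>K\<close>, since
  \<open>x\<close> and \<open>x'\<close> are both orthogonal to \<open>y\<close> and to
  \<open>y'\<close>; what remains says that \<open>y' \<ominus> y\<close> is orthogonal to
  itself.\<close>

lemma orth_component_eq:
  assumes "K \<subseteq> carrier V" "x \<in> K" "y \<in> orth_complement V K"
  shows "orth_component V K (x \<oplus> y) = y"
  unfolding orth_component_def
proof (rule the_equality)
  show "y \<in> orth_complement V K \<and> (\<exists>x'\<in>K. x \<oplus> y = x' \<oplus> y)"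
    using assms by blast
next
  fix y' assume "y' \<in> orth_complement V K \<and> (\<exists>x'\<in>K. x \<oplus> y = x' \<oplus> y')"
  then obtain x' where x': "x' \<in> K" and y': "y' \<in> orth_complement V K"
    and eq: "x \<oplus> y = x' \<oplus> y'" by blast
  have V: "x \<in> carrier V" "x' \<in> carrier V" "y \<in> carrier V" "y' \<in> carrier V"
    using assms x' y' by (auto simp: orth_complement_def)
  have orth: "cinner V x y = 0" "cinner V x y' = 0" "cinner V x' y = 0" "cinner V x' y' = 0"
    using assms x' y' by (auto simp: orth_complement_def)
  have "cinner V y y = cinner V y' y" "cinner V y y' = cinner V y' y'"
    using V orth eq by (metis add_0 ip_add_left)+
  then have "y' \<ominus> y = \<zero>"
    using V by (intro definite) (auto simp: ip_minus_left ip_minus_right)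
  then show "y' = y"
    using V diff_eq_zero_iff by simp
qed

end

section \<open>Completion\<close>

text \<open>The sequences before \<open>cauchy_rel\<close> identifies them. On this module
  \<open>cauchy_ip\<close> is a semi-inner product, which turns \<open>completion\<close> into an
  instance of \<open>pre_hilbert_quotient\<close>.\<close>

definition cauchy_space :: "('v, 'm) cinner_space_scheme \<Rightarrow> (complex, nat \<Rightarrow> 'v) module" where
  "cauchy_space V =
    \<lparr>carrier = cauchy_seqs V, mult = undefined, one = undefined, zero = (\<lambda>n. \<zero>\<^bsub>V\<^esub>),
     add = (\<lambda>s t n. s n \<oplus>\<^bsub>V\<^esub> t n), smult = (\<lambda>c s n. c \<odot>\<^bsub>V\<^esub> s n)\<rparr>"

definition cauchy_ip ::
  "('v, 'm) cinner_space_scheme \<Rightarrow> (nat \<Rightarrow> 'v) \<Rightarrow> (nat \<Rightarrow> 'v) \<Rightarrow> complex" where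
  "cauchy_ip V s t = lim (\<lambda>n. cinner V (s n) (t n))"

context pre_hilbert
begin

lemma cauchy_seqs_iff:
  "s \<in> cauchy_seqs V \<longleftrightarrow> range s \<subseteq> carrier V \<and>
     (\<forall>e>0. \<exists>N. \<forall>n n'. N \<le> n \<longrightarrow> N \<le> n' \<longrightarrow> seminorm (s n \<ominus> s n') < e)"
proof -
  interpret M: Metric_space "carrier V" "cinner_dist V" by (rule Metric_space_cinner_dist)
  show ?thesis
    unfolding cauchy_seqs_def M.MCauchy_def mem_Collect_eq
    by (rule conj_cong) (auto simp: cinner_dist_eq image_subset_iff)
qed

lemma cauchy_seqs_in: "s \<in> cauchy_seqs V \<Longrightarrow> s n \<in> carrier V"
  by (auto simp: cauchy_seqs_iff)

lemma cauchy_seqsD: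
  assumes "s \<in> cauchy_seqs V" "0 < e"
  obtains N where "\<And>n n'. N \<le> n \<Longrightarrow> N \<le> n' \<Longrightarrow> seminorm (s n \<ominus> s n') < e"
  using assms unfolding cauchy_seqs_iff by blast

lemma cauchy_seqsI:
  assumes "\<And>n. s n \<in> carrier V"
    and "\<And>e. 0 < e \<Longrightarrow> \<exists>N. \<forall>n n'. N \<le> n \<longrightarrow> N \<le> n' \<longrightarrow> seminorm (s n \<ominus> s n') < e"
  shows "s \<in> cauchy_seqs V"
  using assms unfolding cauchy_seqs_iff by blast

lemma cauchy_seqs_const: "x \<in> carrier V \<Longrightarrow> (\<lambda>n. x) \<in> cauchy_seqs V"
  by (rule cauchy_seqsI) auto

lemma cauchy_seqs_add:
  assumes s: "s \<in> cauchy_seqs V" and t: "t \<in> cauchy_seqs V"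
  shows "(\<lambda>n. s n \<oplus> t n) \<in> cauchy_seqs V"
proof (rule cauchy_seqsI)
  fix e :: real assume "0 < e"
  then have "0 < e / 2" by simp
  obtain N where N: "\<And>n n'. N \<le> n \<Longrightarrow> N \<le> n' \<Longrightarrow> seminorm (s n \<ominus> s n') < e / 2"
    using cauchy_seqsD[OF s \<open>0 < e / 2\<close>] by blast
  obtain N' where N': "\<And>n n'. N' \<le> n \<Longrightarrow> N' \<le> n' \<Longrightarrow> seminorm (t n \<ominus> t n') < e / 2"
    using cauchy_seqsD[OF t \<open>0 < e / 2\<close>] by blast
  have "seminorm ((s n \<oplus> t n) \<ominus> (s n' \<oplus> t n')) < e"
    if "max N N' \<le> n" "max N N' \<le> n'" for n n'
    using that N[of n n'] N'[of n n'] seminorm_diff_add[of "s n" "t n" "s n'" "t n'"]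
    by (simp add: cauchy_seqs_in[OF s] cauchy_seqs_in[OF t])
  then show "\<exists>N. \<forall>n n'. N \<le> n \<longrightarrow> N \<le> n' \<longrightarrow> seminorm ((s n \<oplus> t n) \<ominus> (s n' \<oplus> t n')) < e"
    by blast
qed (simp add: cauchy_seqs_in[OF s] cauchy_seqs_in[OF t])

lemma cauchy_seqs_smult:
  assumes s: "s \<in> cauchy_seqs V"
  shows "(\<lambda>n. c \<odot> s n) \<in> cauchy_seqs V"
proof (rule cauchy_seqsI)
  fix e :: real assume "0 < e"
  \<comment> \<open>Adding 1 keeps the tolerance positive for \<open>c = 0\<close>.\<close>
  then have "0 < e / (cmod c + 1)" by (simp add: add_nonneg_pos)
  obtain N where N: "\<And>n n'. N \<le> n \<Longrightarrow> N \<le> n' \<Longrightarrow> seminorm (s n \<ominus> s n') < e / (cmod c + 1)"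
    using cauchy_seqsD[OF s \<open>0 < e / (cmod c + 1)\<close>] by blast
  have "seminorm (c \<odot> s n \<ominus> c \<odot> s n') < e" if "N \<le> n" "N \<le> n'" for n n'
  proof -
    have "seminorm (c \<odot> s n \<ominus> c \<odot> s n') \<le> (cmod c + 1) * seminorm (s n \<ominus> s n')"
      using seminorm_nonneg[of "s n \<ominus> s n'"]
      by (simp add: smult_diff seminorm_smult cauchy_seqs_in[OF s] algebra_simps)
    also have "\<dots> < e"
      using N[OF that] by (simp add: pos_less_divide_eq add_nonneg_pos mult.commute)
    finally show ?thesis .
  qed
  then show "\<exists>N. \<forall>n n'. N \<le> n \<longrightarrow> N \<le> n' \<longrightarrow> seminorm (c \<odot> s n \<ominus> c \<odot> s n') < e"
    by blast
qed (simp add: cauchy_seqs_in[OF s])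

lemma cauchy_seqs_bounded:
  assumes s: "s \<in> cauchy_seqs V"
  obtains B where "0 < B" "\<And>n. seminorm (s n) \<le> B"
proof -
  obtain N where N: "\<And>n n'. N \<le> n \<Longrightarrow> N \<le> n' \<Longrightarrow> seminorm (s n \<ominus> s n') < 1"
    using cauchy_seqsD[OF s zero_less_one] by blast
  \<comment> \<open>The maximum bounds the terms up to \<open>N\<close>; the added 1 absorbs the
    distance of later terms from \<open>s N\<close>.\<close>
  define B where "B = Max ((\<lambda>n. seminorm (s n)) ` {..N}) + 1"
  have le: "seminorm (s n) \<le> B - 1" if "n \<le> N" for n
    unfolding B_def using that by (auto intro: Max_ge)
  have "seminorm (s n) \<le> B" for n
  proof (cases "n \<le> N")
    case True then show ?thesis using le by fastforce
  next
    case False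
    then show ?thesis
      using N[of n N] le[of N] seminorm_le_diff[of "s n" "s N"] cauchy_seqs_in[OF s]
      by fastforce
  qed
  moreover have "0 < B" using le[of N] seminorm_nonneg[OF cauchy_seqs_in[OF s], of N] by simp
  ultimately show thesis by (rule that[rotated])
qed

text \<open>Each error term of \<open>ip_diff_bound\<close> is a small difference times a bounded
  factor. So the inner products form a Cauchy sequence of complex numbers, and the
  \<open>lim\<close> in \<open>cauchy_ip\<close> is a genuine limit.\<close>

lemma cauchy_ip_LIMSEQ:
  assumes s: "s \<in> cauchy_seqs V" and t: "t \<in> cauchy_seqs V"
  shows "(\<lambda>n. cinner V (s n) (t n)) \<longlonglongrightarrow> cauchy_ip V s t"
proof -
  obtain B where B: "0 < B" "\<And>n. seminorm (s n) \<le> B" using cauchy_seqs_bounded[OF s] by blast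
  obtain C where C: "0 < C" "\<And>n. seminorm (t n) \<le> C" using cauchy_seqs_bounded[OF t] by blast
  note V = cauchy_seqs_in[OF s] cauchy_seqs_in[OF t]
  have "Cauchy (\<lambda>n. cinner V (s n) (t n))"
  proof (rule metric_CauchyI)
    fix e :: real assume "0 < e"
    \<comment> \<open>The tolerances are crossed: differences of \<open>s\<close> get multiplied by
      the bound \<open>C\<close> of \<open>t\<close>, differences of \<open>t\<close> by the bound
      \<open>B\<close> of \<open>s\<close>.\<close>
    then have e: "0 < e / (2 * C)" "0 < e / (2 * B)" using B C by auto
    obtain N where N: "\<And>n n'. N \<le> n \<Longrightarrow> N \<le> n' \<Longrightarrow> seminorm (s n \<ominus> s n') < e / (2 * C)"
      using cauchy_seqsD[OF s e(1)] by blast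
    obtain N' where N': "\<And>n n'. N' \<le> n \<Longrightarrow> N' \<le> n' \<Longrightarrow> seminorm (t n \<ominus> t n') < e / (2 * B)"
      using cauchy_seqsD[OF t e(2)] by blast
    have "dist (cinner V (s n) (t n)) (cinner V (s n') (t n')) < e"
      if "max N N' \<le> n" "max N N' \<le> n'" for n n'
    proof -
      have "seminorm (s n) * seminorm (t n \<ominus> t n') \<le> B * seminorm (t n \<ominus> t n')"
        using B V by (intro mult_right_mono) auto
      also have "\<dots> < B * (e / (2 * B))"
        using B N' that by (intro mult_strict_left_mono) auto
      finally have 1: "seminorm (s n) * seminorm (t n \<ominus> t n') < e / 2" using B by simp
      have "seminorm (s n \<ominus> s n') * seminorm (t n') \<le> seminorm (s n \<ominus> s n') * C"
        using C V by (intro mult_left_mono) auto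
      also have "\<dots> < e / (2 * C) * C"
        using C N that by (intro mult_strict_right_mono) auto
      finally have "seminorm (s n \<ominus> s n') * seminorm (t n') < e / 2" using C by simp
      with 1 show ?thesis
        using ip_diff_bound[of "s n" "t n" "s n'" "t n'"] V by (simp add: dist_norm)
    qed
    then show "\<exists>M. \<forall>m\<ge>M. \<forall>n\<ge>M. dist (cinner V (s m) (t m)) (cinner V (s n) (t n)) < e"
      by blast
  qed
  then show ?thesis
    unfolding cauchy_ip_def by (simp add: Cauchy_convergent_iff convergent_LIMSEQ_iff)
qed

lemma cauchy_ip_eqI:
  "\<lbrakk>s \<in> cauchy_seqs V; t \<in> cauchy_seqs V; (\<lambda>n. cinner V (s n) (t n)) \<longlonglongrightarrow> l\<rbrakk> \<Longrightarrow> cauchy_ip V s t = l"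
  using cauchy_ip_LIMSEQ LIMSEQ_unique by blast

text \<open>Every law holds termwise and passes to the limit; nonnegativity survives because the
  nonnegative reals are closed in the complex plane.\<close>

lemma semi_inner_product_cauchy_space: "semi_inner_product (cauchy_space V) (cauchy_ip V)"
proof -
  note [simp] = cauchy_space_def
  have "abelian_group (cauchy_space V)"
  proof (rule abelian_groupI)
    fix s assume "s \<in> carrier (cauchy_space V)"
    then have s: "s \<in> cauchy_seqs V" by simp
    have "(-1) \<odot> s n \<oplus> s n = \<zero>" for n
      using cauchy_seqs_in[OF s] by (simp add: minus_eq_smult[symmetric] l_neg)
    then show "\<exists>t\<in>carrier (cauchy_space V).
        t \<oplus>\<^bsub>cauchy_space V\<^esub> s = \<zero>\<^bsub>cauchy_space V\<^esub>"
      using cauchy_seqs_smult[OF s, of "-1"] by (intro bexI[of _ "\<lambda>n. (-1) \<odot> s n"]) auto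
  qed (auto simp: cauchy_seqs_add cauchy_seqs_const a_ac cauchy_seqs_in)
  then have "module complex_ring (cauchy_space V)"
  proof (rule moduleI[OF cring_complex_ring])
    fix a b :: complex and s
    assume "s \<in> carrier (cauchy_space V)"
    then have "s n \<in> carrier V" for n by (simp add: cauchy_seqs_in)
    then show "(a \<oplus>\<^bsub>complex_ring\<^esub> b) \<odot>\<^bsub>cauchy_space V\<^esub> s =
        a \<odot>\<^bsub>cauchy_space V\<^esub> s \<oplus>\<^bsub>cauchy_space V\<^esub> b \<odot>\<^bsub>cauchy_space V\<^esub> s"
      using smult_l_distr[of a b] by auto
  next
    fix a b :: complex and s
    assume "s \<in> carrier (cauchy_space V)"
    then have "s n \<in> carrier V" for n by (simp add: cauchy_seqs_in)
    then show "(a \<otimes>\<^bsub>complex_ring\<^esub> b) \<odot>\<^bsub>cauchy_space V\<^esub> s =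
        a \<odot>\<^bsub>cauchy_space V\<^esub> (b \<odot>\<^bsub>cauchy_space V\<^esub> s)"
      using smult_assoc1[of a b] by auto
  next
    fix a :: complex and s t
    assume "s \<in> carrier (cauchy_space V)" "t \<in> carrier (cauchy_space V)"
    then have "s n \<in> carrier V" "t n \<in> carrier V" for n by (simp_all add: cauchy_seqs_in)
    then show "a \<odot>\<^bsub>cauchy_space V\<^esub> (s \<oplus>\<^bsub>cauchy_space V\<^esub> t) =
        a \<odot>\<^bsub>cauchy_space V\<^esub> s \<oplus>\<^bsub>cauchy_space V\<^esub> a \<odot>\<^bsub>cauchy_space V\<^esub> t"
      using smult_r_distr[of a] by auto
  qed (use smult_one in \<open>auto simp: cauchy_seqs_smult cauchy_seqs_in\<close>)
  then show ?thesis
  proof (intro semi_inner_product.intro semi_inner_product_axioms.intro)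
    fix s t u assume "s \<in> carrier (cauchy_space V)" "t \<in> carrier (cauchy_space V)"
      "u \<in> carrier (cauchy_space V)"
    then have s: "s \<in> cauchy_seqs V" and t: "t \<in> cauchy_seqs V" and u: "u \<in> cauchy_seqs V"
      by simp_all
    note V = cauchy_seqs_in[OF s] cauchy_seqs_in[OF t] cauchy_seqs_in[OF u]
    note L = cauchy_ip_LIMSEQ
    show "cauchy_ip V (s \<oplus>\<^bsub>cauchy_space V\<^esub> t) u = cauchy_ip V s u + cauchy_ip V t u"
      using tendsto_add[OF L[OF s u] L[OF t u]]
      by (auto intro!: cauchy_ip_eqI simp: ip_add_left V cauchy_seqs_add s t u)
    show "cauchy_ip V s (t \<oplus>\<^bsub>cauchy_space V\<^esub> u) = cauchy_ip V s t + cauchy_ip V s u"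
      using tendsto_add[OF L[OF s t] L[OF s u]]
      by (auto intro!: cauchy_ip_eqI simp: ip_add_right V cauchy_seqs_add s t u)
  next
    fix c s t assume "s \<in> carrier (cauchy_space V)" "t \<in> carrier (cauchy_space V)"
    then have s: "s \<in> cauchy_seqs V" and t: "t \<in> cauchy_seqs V"
      by simp_all
    note V = cauchy_seqs_in[OF s] cauchy_seqs_in[OF t]
    note L = cauchy_ip_LIMSEQ[OF s t]
    show "cauchy_ip V (c \<odot>\<^bsub>cauchy_space V\<^esub> s) t = cnj c * cauchy_ip V s t"
      using tendsto_mult_left[OF L, of "cnj c"]
      by (auto intro!: cauchy_ip_eqI simp: ip_smult_left V cauchy_seqs_smult s t)
    show "cauchy_ip V s (c \<odot>\<^bsub>cauchy_space V\<^esub> t) = c * cauchy_ip V s t"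
      using tendsto_mult_left[OF L, of c]
      by (auto intro!: cauchy_ip_eqI simp: ip_smult_right V cauchy_seqs_smult s t)
  next
    fix s assume "s \<in> carrier (cauchy_space V)"
    then have s: "s \<in> cauchy_seqs V" by simp
    show "cauchy_ip V s s \<in> \<real>\<^sub>\<ge>\<^sub>0"
      by (rule closed_sequentially[OF closed_nonneg_Reals_complex _ cauchy_ip_LIMSEQ[OF s s]])
        (simp add: ip_nonneg cauchy_seqs_in[OF s])
  qed
qed

lemma cauchy_rel_iff:
  "(s, t) \<in> cauchy_rel V \<longleftrightarrow> s \<in> cauchy_seqs V \<and> t \<in> cauchy_seqs V \<and>
     (\<lambda>n. seminorm (s n \<ominus> t n)) \<longlonglongrightarrow> 0"
  by (auto simp: cauchy_rel_def cinner_dist_eq cauchy_seqs_in)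

lemma equiv_cauchy_rel: "equiv (cauchy_seqs V) (cauchy_rel V)"
proof (rule equivI)
  show "cauchy_rel V \<subseteq> cauchy_seqs V \<times> cauchy_seqs V"
    by (auto simp: cauchy_rel_iff)
  show "refl_on (cauchy_seqs V) (cauchy_rel V)"
    by (rule refl_onI) (auto simp: cauchy_rel_iff cauchy_seqs_in)
  show "sym (cauchy_rel V)"
    by (rule symI) (auto simp: cauchy_rel_iff cauchy_seqs_in seminorm_diff_commute)
  show "trans (cauchy_rel V)"
  proof (rule transI)
    fix s t u assume "(s, t) \<in> cauchy_rel V" "(t, u) \<in> cauchy_rel V"
    then have s: "s \<in> cauchy_seqs V" and t: "t \<in> cauchy_seqs V" and u: "u \<in> cauchy_seqs V"
      and lim: "(\<lambda>n. seminorm (s n \<ominus> t n)) \<longlonglongrightarrow> 0" "(\<lambda>n. seminorm (t n \<ominus> u n)) \<longlonglongrightarrow> 0"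
      unfolding cauchy_rel_iff by blast+
    have "norm (seminorm (s n \<ominus> u n)) \<le> seminorm (s n \<ominus> t n) + seminorm (t n \<ominus> u n)" for n
      using seminorm_diff_triangle[of "s n" "t n" "u n"]
      by (simp add: cauchy_seqs_in[OF s] cauchy_seqs_in[OF t] cauchy_seqs_in[OF u])
    moreover have "(\<lambda>n. seminorm (s n \<ominus> t n) + seminorm (t n \<ominus> u n)) \<longlonglongrightarrow> 0"
      using tendsto_add[OF lim] by simp
    ultimately have "(\<lambda>n. seminorm (s n \<ominus> u n)) \<longlonglongrightarrow> 0"
      by (metis (no_types, lifting) Lim_null_comparison always_eventually)
    with s u show "(s, u) \<in> cauchy_rel V" by (simp add: cauchy_rel_iff)
  qed
qed

lemma cauchy_space_diff:
  assumes s: "s \<in> cauchy_seqs V" and t: "t \<in> cauchy_seqs V"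
  shows "s \<ominus>\<^bsub>cauchy_space V\<^esub> t = (\<lambda>n. s n \<ominus> t n)"
proof -
  interpret C: semi_inner_product "cauchy_space V" "cauchy_ip V"
    by (rule semi_inner_product_cauchy_space)
  have "s \<ominus>\<^bsub>cauchy_space V\<^esub> t = s \<oplus>\<^bsub>cauchy_space V\<^esub> (-1) \<odot>\<^bsub>cauchy_space V\<^esub> t"
    using s t by (simp add: C.minus_eq_smult[unfolded cauchy_space_def] a_minus_def cauchy_space_def)
  then show ?thesis
    by (simp add: cauchy_space_def a_minus_def minus_eq_smult cauchy_seqs_in[OF t])
qed

lemma cauchy_seminorm_LIMSEQ:
  assumes "s \<in> cauchy_seqs V"
  shows "(\<lambda>n. seminorm (s n)) \<longlonglongrightarrow> semi_inner_product.seminorm (cauchy_ip V) s"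
proof -
  interpret C: semi_inner_product "cauchy_space V" "cauchy_ip V"
    by (rule semi_inner_product_cauchy_space)
  show ?thesis
    unfolding seminorm_def C.seminorm_def
    by (intro tendsto_intros cauchy_ip_LIMSEQ assms)
qed

lemma cauchy_diff_LIMSEQ:
  assumes "s \<in> cauchy_seqs V" "t \<in> cauchy_seqs V"
  shows "(\<lambda>n. seminorm (s n \<ominus> t n)) \<longlonglongrightarrow>
    semi_inner_product.seminorm (cauchy_ip V) (s \<ominus>\<^bsub>cauchy_space V\<^esub> t)"
proof -
  interpret C: semi_inner_product "cauchy_space V" "cauchy_ip V"
    by (rule semi_inner_product_cauchy_space)
  have "(\<lambda>n. s n \<ominus> t n) \<in> cauchy_seqs V"
    using C.M.minus_closed[of s t] assms by (simp add: cauchy_space_diff) (simp add: cauchy_space_def)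
  then show ?thesis
    using cauchy_seminorm_LIMSEQ cauchy_space_diff[OF assms] by simp
qed

text \<open>The distances in \<open>cauchy_rel\<close> converge to the seminorm of the difference
  under \<open>cauchy_ip\<close>. Hence \<open>cauchy_rel\<close> is the relation of differing by a
  null vector of that form.\<close>

lemma cauchy_rel_iff_ip:
  assumes s: "s \<in> cauchy_seqs V" and t: "t \<in> cauchy_seqs V"
  shows "(s, t) \<in> cauchy_rel V \<longleftrightarrow>
    semi_inner_product.seminorm (cauchy_ip V) (s \<ominus>\<^bsub>cauchy_space V\<^esub> t) = 0"
  using assms cauchy_diff_LIMSEQ[OF assms] unfolding cauchy_rel_iff by (metis LIMSEQ_unique)

abbreviation cls :: "(nat \<Rightarrow> 'v) \<Rightarrow> (nat \<Rightarrow> 'v) set" where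
  "cls s \<equiv> cauchy_rel V `` {s}"

lemma cls_eq_iff:
  "\<lbrakk>s \<in> cauchy_seqs V; t \<in> cauchy_seqs V\<rbrakk> \<Longrightarrow> cls s = cls t \<longleftrightarrow> (s, t) \<in> cauchy_rel V"
  using eq_equiv_class_iff[OF equiv_cauchy_rel] by blast

lemma cls_self: "s \<in> cauchy_seqs V \<Longrightarrow> s \<in> cls s"
  by (rule equiv_class_self[OF equiv_cauchy_rel])

lemma mem_cls_iff:
  assumes "s \<in> cauchy_seqs V"
  shows "t \<in> cls s \<longleftrightarrow> t \<in> cauchy_seqs V \<and>
    semi_inner_product.seminorm (cauchy_ip V) (t \<ominus>\<^bsub>cauchy_space V\<^esub> s) = 0"
proof -
  have "t \<in> cls s \<longleftrightarrow> (t, s) \<in> cauchy_rel V"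
    using equiv_cauchy_rel by (auto simp: equiv_def dest: symD)
  then show ?thesis
    using assms cauchy_rel_iff_ip[of t s] by (auto simp: cauchy_rel_iff)
qed

text \<open>The double union in \<open>completion\<close> runs over all representatives. It
  collapses because any other pair changes the sum by a null vector of \<open>cauchy_ip\<close>
  only, hence yields the same class.\<close>

lemma completion_add:
  assumes s: "s \<in> cauchy_seqs V" and t: "t \<in> cauchy_seqs V"
  shows "cls s \<oplus>\<^bsub>completion V\<^esub> cls t = cls (s \<oplus>\<^bsub>cauchy_space V\<^esub> t)"
proof -
  interpret C: semi_inner_product "cauchy_space V" "cauchy_ip V"
    by (rule semi_inner_product_cauchy_space)
  have carrier: "carrier (cauchy_space V) = cauchy_seqs V"
    by (simp add: cauchy_space_def)
  note closed = C.a_closed[unfolded carrier] and minus_closed = C.M.minus_closed[unfolded carrier]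
  have add: "cls (s' \<oplus>\<^bsub>cauchy_space V\<^esub> t') = cls (s \<oplus>\<^bsub>cauchy_space V\<^esub> t)"
    if "s' \<in> cls s" "t' \<in> cls t" for s' t'
  proof -
    have st: "s' \<in> cauchy_seqs V" "t' \<in> cauchy_seqs V"
      "C.seminorm (s' \<ominus>\<^bsub>cauchy_space V\<^esub> s) = 0" "C.seminorm (t' \<ominus>\<^bsub>cauchy_space V\<^esub> t) = 0"
      using that unfolding mem_cls_iff[OF s] mem_cls_iff[OF t] by blast+
    then have "C.seminorm ((s' \<oplus>\<^bsub>cauchy_space V\<^esub> t') \<ominus>\<^bsub>cauchy_space V\<^esub> (s \<oplus>\<^bsub>cauchy_space V\<^esub> t)) \<le> 0"
      using C.seminorm_diff_add[of s' t' s t] s t unfolding carrier by simp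
    moreover have "0 \<le> C.seminorm ((s' \<oplus>\<^bsub>cauchy_space V\<^esub> t') \<ominus>\<^bsub>cauchy_space V\<^esub> (s \<oplus>\<^bsub>cauchy_space V\<^esub> t))"
      using st s t by (intro C.seminorm_nonneg) (simp add: carrier closed minus_closed)
    ultimately show ?thesis
      using st s t by (subst cls_eq_iff) (auto simp: cauchy_rel_iff_ip closed)
  qed
  have "cls s \<oplus>\<^bsub>completion V\<^esub> cls t = (\<Union>s'\<in>cls s. \<Union>t'\<in>cls t. cls (s' \<oplus>\<^bsub>cauchy_space V\<^esub> t'))"
    by (simp add: completion_def cauchy_space_def)
  also have "\<dots> = (\<Union>s'\<in>cls s. \<Union>t'\<in>cls t. cls (s \<oplus>\<^bsub>cauchy_space V\<^esub> t))"
    by (intro SUP_cong refl add)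
  also have "\<dots> = cls (s \<oplus>\<^bsub>cauchy_space V\<^esub> t)"
    using cls_self[OF s] cls_self[OF t] by blast
  finally show ?thesis .
qed

lemma completion_smult:
  assumes s: "s \<in> cauchy_seqs V"
  shows "c \<odot>\<^bsub>completion V\<^esub> cls s = cls (c \<odot>\<^bsub>cauchy_space V\<^esub> s)"
proof -
  interpret C: semi_inner_product "cauchy_space V" "cauchy_ip V"
    by (rule semi_inner_product_cauchy_space)
  have carrier: "carrier (cauchy_space V) = cauchy_seqs V"
    by (simp add: cauchy_space_def)
  have smult: "cls (c \<odot>\<^bsub>cauchy_space V\<^esub> s') = cls (c \<odot>\<^bsub>cauchy_space V\<^esub> s)"
    if "s' \<in> cls s" for s'
  proof -
    have st: "s' \<in> cauchy_seqs V" "C.seminorm (s' \<ominus>\<^bsub>cauchy_space V\<^esub> s) = 0"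
      using that unfolding mem_cls_iff[OF s] by blast+
    then have "C.seminorm (c \<odot>\<^bsub>cauchy_space V\<^esub> s' \<ominus>\<^bsub>cauchy_space V\<^esub> c \<odot>\<^bsub>cauchy_space V\<^esub> s) = 0"
      using s carrier C.minus_closed[of s' s] by (simp add: C.smult_diff C.seminorm_smult)
    then show ?thesis
      using st s by (subst cls_eq_iff) (simp_all add: cauchy_rel_iff_ip C.smult_in[unfolded carrier])
  qed
  have "c \<odot>\<^bsub>completion V\<^esub> cls s = (\<Union>s'\<in>cls s. cls (c \<odot>\<^bsub>cauchy_space V\<^esub> s'))"
    by (simp add: completion_def cauchy_space_def)
  also have "\<dots> = (\<Union>s'\<in>cls s. cls (c \<odot>\<^bsub>cauchy_space V\<^esub> s))"
    by (intro SUP_cong refl smult)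
  also have "\<dots> = cls (c \<odot>\<^bsub>cauchy_space V\<^esub> s)"
    using cls_self[OF s] by blast
  finally show ?thesis .
qed

text \<open>Whatever representatives \<open>SOME\<close> picks, they differ from \<open>s\<close>
  and \<open>t\<close> by null vectors of \<open>cauchy_ip\<close>.\<close>

lemma completion_cinner:
  assumes s: "s \<in> cauchy_seqs V" and t: "t \<in> cauchy_seqs V"
  shows "cinner (completion V) (cls s) (cls t) = cauchy_ip V s t"
proof -
  interpret C: semi_inner_product "cauchy_space V" "cauchy_ip V"
    by (rule semi_inner_product_cauchy_space)
  have carrier: "carrier (cauchy_space V) = cauchy_seqs V"
    by (simp add: cauchy_space_def)
  have "(SOME s'. s' \<in> cls s) \<in> cls s" "(SOME t'. t' \<in> cls t) \<in> cls t"
    unfolding some_in_eq using cls_self[OF s] cls_self[OF t] by blast+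
  then have "cauchy_ip V (SOME s'. s' \<in> cls s) (SOME t'. t' \<in> cls t) = cauchy_ip V s t"
    unfolding mem_cls_iff[OF s] mem_cls_iff[OF t] using s t C.ip_null carrier by blast
  then show ?thesis
    by (simp add: completion_def cauchy_ip_def)
qed

lemma carrier_completion: "carrier (completion V) = cls ` cauchy_seqs V"
  by (auto simp: completion_def quotient_def)

lemma pre_hilbert_completion: "pre_hilbert (completion V)"
proof -
  interpret C: semi_inner_product "cauchy_space V" "cauchy_ip V"
    by (rule semi_inner_product_cauchy_space)
  have carrier: "carrier (cauchy_space V) = cauchy_seqs V"
    by (simp add: cauchy_space_def)
  have zero: "cls \<zero>\<^bsub>cauchy_space V\<^esub> = \<zero>\<^bsub>completion V\<^esub>"
    by (simp add: cauchy_space_def completion_def)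
  show ?thesis
  proof (rule C.pre_hilbert_quotient[where q = cls])
    fix s assume s: "s \<in> carrier (cauchy_space V)" and null: "cauchy_ip V s s = 0"
    have "C.seminorm (s \<ominus>\<^bsub>cauchy_space V\<^esub> \<zero>\<^bsub>cauchy_space V\<^esub>) = 0"
      using null s C.ip_self[of s] by (simp add: C.minus_zero_right)
    then have "cls s = cls \<zero>\<^bsub>cauchy_space V\<^esub>"
      using s C.zero_closed unfolding carrier by (simp add: cls_eq_iff cauchy_rel_iff_ip)
    then show "cls s = \<zero>\<^bsub>completion V\<^esub>" by (simp add: zero)
  qed (use zero in \<open>auto simp: carrier carrier_completion completion_add completion_smult completion_cinner\<close>)
qed

lemma completion_embed_in: "v \<in> carrier V \<Longrightarrow> completion_embed V v \<in> carrier (completion V)"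
  by (auto simp: completion_embed_def carrier_completion cauchy_seqs_const)

text \<open>A Cauchy sequence converges in the completion to its own class: the constant sequence at
  a late term \<open>s N\<close> is close to \<open>s\<close> itself.\<close>

lemma cls_in_closure:
  assumes s: "s \<in> cauchy_seqs V" and S: "S \<subseteq> carrier V" and "\<And>n. s n \<in> S"
  shows "cls s \<in> cinner_topology (completion V) closure_of (completion_embed V ` S)"
proof -
  interpret C: semi_inner_product "cauchy_space V" "cauchy_ip V"
    by (rule semi_inner_product_cauchy_space)
  interpret H: pre_hilbert "completion V"
    by (rule pre_hilbert_completion)
  interpret M: Metric_space "carrier (completion V)" "cinner_dist (completion V)"
    by (rule H.Metric_space_cinner_dist)
  have cls_s: "cls s \<in> carrier (completion V)"
    using s by (simp add: carrier_completion)
  have "\<exists>y\<in>completion_embed V ` S. y \<in> M.mball (cls s) r" if "0 < r" for r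
  proof -
    \<comment> \<open>Half of \<open>r\<close>, because the limit weakens the strict Cauchy bound to
      \<open>\<le>\<close>.\<close>
    from that have "0 < r / 2" by simp
    then obtain N where N: "\<And>n n'. N \<le> n \<Longrightarrow> N \<le> n' \<Longrightarrow> seminorm (s n \<ominus> s n') < r / 2"
      using cauchy_seqsD[OF s] by blast
    define c where "c = (\<lambda>n::nat. s N)"
    have c: "c \<in> cauchy_seqs V"
      using cauchy_seqs_const cauchy_seqs_in[OF s] by (simp add: c_def)
    have embed: "completion_embed V (s N) = cls c"
      by (simp add: completion_embed_def c_def)
    have cls_c: "cls c \<in> carrier (completion V)"
      using c by (simp add: carrier_completion)
    have carrier: "s \<in> carrier (cauchy_space V)" "c \<in> carrier (cauchy_space V)"
      using s c by (simp_all add: cauchy_space_def)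
    have smult_c: "(- 1) \<odot>\<^bsub>cauchy_space V\<^esub> c \<in> cauchy_seqs V"
      using C.smult_in[OF carrier(2), of "-1"] by (simp add: cauchy_space_def)
    have "cls s \<ominus>\<^bsub>completion V\<^esub> cls c = cls (s \<ominus>\<^bsub>cauchy_space V\<^esub> c)"
      using s c cls_c carrier smult_c
      by (simp add: a_minus_def H.minus_eq_smult C.minus_eq_smult completion_add completion_smult)
    moreover have "s \<ominus>\<^bsub>cauchy_space V\<^esub> c \<in> cauchy_seqs V"
      using C.M.minus_closed[OF carrier] by (simp add: cauchy_space_def)
    ultimately have "cinner_dist (completion V) (cls s) (cls c) =
        C.seminorm (s \<ominus>\<^bsub>cauchy_space V\<^esub> c)"
      using cls_s cls_c
      by (simp add: H.cinner_dist_eq H.seminorm_def C.seminorm_def completion_cinner)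
    also have "\<dots> \<le> r / 2"
      using cauchy_diff_LIMSEQ[OF s c] N
      by (intro LIMSEQ_le_const2) (auto simp: c_def intro!: exI[of _ N] less_imp_le)
    finally have "cls c \<in> M.mball (cls s) r"
      using \<open>0 < r\<close> cls_s cls_c by simp
    then show ?thesis using assms(3)[of N] embed by blast
  qed
  with cls_s show ?thesis
    unfolding cinner_topology_def M.metric_closure_of by blast
qed

end

section \<open>The GNS space\<close>

text \<open>The union over representatives collapses as soon as scaling preserves \<open>N\<close>.
  This serves two subgroups: \<open>gns_null\<close> for the GNS space and \<open>I\<close> for the
  quotient algebra.\<close>

lemma (in star_algebra) coset_smult_rcos:
  assumes "abelian_subgroup N A" and N: "\<And>n. n \<in> N \<Longrightarrow> c \<odot> n \<in> N" and a: "a \<in> carrier A"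
  shows "coset_smult A N c (N +> a) = N +> (c \<odot> a)"
proof -
  interpret N: abelian_subgroup N A by fact
  have smult: "c \<odot> x \<in> carrier A" if "x \<in> carrier A" for x
    using smult_closed[of c x] that by simp
  have "N +> (c \<odot> b) = N +> (c \<odot> a)" if "b \<in> N +> a" for b
  proof -
    have b: "b \<in> carrier A"
      using that a N.a_elemrcos_carrier by blast
    have "c \<odot> (b \<ominus> a) \<in> N"
      using that a b N.a_rcos_module_minus[OF ring_axioms a b] by (intro N) simp
    then have "c \<odot> b \<ominus> c \<odot> a \<in> N"
      using a b smult_r_distr[of c b "\<ominus> a"] smult_r_minus[of c a] by (simp add: a_minus_def)
    then show ?thesis
      using a b smult N.a_rcos_module_minus[OF ring_axioms, of "c \<odot> a" "c \<odot> b"]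
        N.a_repr_independence'[of "c \<odot> b" "c \<odot> a"] by simp
  qed
  moreover have "a \<in> N +> a" by (rule N.a_rcos_self[OF a])
  ultimately show ?thesis unfolding coset_smult_def by blast
qed

lemma (in star_algebra) star_minus:
  assumes "x \<in> carrier A" "y \<in> carrier A"
  shows "star A (x \<ominus> y) = star A x \<ominus> star A y"
proof -
  have "star A x = star A (x \<ominus> y) \<oplus> star A y"
    using assms star_add[of "x \<ominus> y" y] by (simp add: a_minus_def a_assoc l_neg)
  then show ?thesis
    using assms by (simp add: star_closed a_minus_def a_assoc r_neg)
qed

lemma (in star_algebra) coset_star_rcos:
  assumes "abelian_subgroup N A" and N: "\<And>n. n \<in> N \<Longrightarrow> star A n \<in> N" and a: "a \<in> carrier A"
  shows "coset_star A N (N +> a) = N +> star A a"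
proof -
  interpret N: abelian_subgroup N A by fact
  have "N +> star A b = N +> star A a" if "b \<in> N +> a" for b
  proof -
    have b: "b \<in> carrier A"
      using that a N.a_elemrcos_carrier by blast
    have "star A (b \<ominus> a) \<in> N"
      using that a b N.a_rcos_module_minus[OF ring_axioms a b] by (intro N) simp
    then show ?thesis
      using a b star_closed N.a_rcos_module_minus[OF ring_axioms, of "star A a" "star A b"]
        N.a_repr_independence'[of "star A b" "star A a"] by (simp add: star_minus)
  qed
  moreover have "a \<in> N +> a" by (rule N.a_rcos_self[OF a])
  ultimately show ?thesis unfolding coset_star_def by blast
qed

context quantum_measure_space
begin

lemma semi_inner_product_gns: "semi_inner_product A (\<lambda>a b. \<phi> (star A a \<otimes> b))"
proof (intro semi_inner_product.intro semi_inner_product_axioms.intro)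
  fix x y z assume "x \<in> carrier A" "y \<in> carrier A" "z \<in> carrier A"
  then show "\<phi> (star A (x \<oplus> y) \<otimes> z) = \<phi> (star A x \<otimes> z) + \<phi> (star A y \<otimes> z)"
    "\<phi> (star A x \<otimes> (y \<oplus> z)) = \<phi> (star A x \<otimes> y) + \<phi> (star A x \<otimes> z)"
    by (simp_all add: star_add star_closed l_distr r_distr functional_add)
next
  fix c x y assume "x \<in> carrier A" "y \<in> carrier A"
  then show "\<phi> (star A (c \<odot> x) \<otimes> y) = cnj c * \<phi> (star A x \<otimes> y)"
    "\<phi> (star A x \<otimes> (c \<odot> y)) = c * \<phi> (star A x \<otimes> y)"
    by (simp_all add: star_smult star_closed smult_mult_left smult_mult_right functional_smult)
next
  fix x assume "x \<in> carrier A"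
  then show "\<phi> (star A x \<otimes> x) \<in> \<real>\<^sub>\<ge>\<^sub>0"
    by (intro functional_positive) (auto simp: positive_elements_def)
qed (rule module_axioms)

sublocale gns: semi_inner_product A "\<lambda>a b. \<phi> (star A a \<otimes> b)"
  by (rule semi_inner_product_gns)

lemma gns_null_iff: "a \<in> gns_null A \<phi> \<longleftrightarrow> a \<in> carrier A \<and> gns.seminorm a = 0"
  by (auto simp: gns_null_def gns.ip_self)

text \<open>\<open>gns_null\<close> is the zero set of the GNS seminorm, so closure under addition
  is the triangle inequality.\<close>

lemma abelian_subgroup_gns_null: "abelian_subgroup (gns_null A \<phi>) A"
proof (rule abelian_subgroupI3)
  show "additive_subgroup (gns_null A \<phi>) A"
  proof (rule additive_subgroupI, rule add.subgroupI)
    show "gns_null A \<phi> \<subseteq> carrier A" by (auto simp: gns_null_iff)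
    show "gns_null A \<phi> \<noteq> {}" using gns_null_iff[of \<zero>] by auto
    fix a b assume a: "a \<in> gns_null A \<phi>"
    then show "\<ominus> a \<in> gns_null A \<phi>" by (simp add: gns_null_iff gns.seminorm_minus)
    assume "b \<in> gns_null A \<phi>"
    with a show "a \<oplus> b \<in> gns_null A \<phi>"
      using gns.seminorm_triangle[of a b] gns.seminorm_nonneg[of "a \<oplus> b"]
      by (simp add: gns_null_iff order_antisym)
  qed
qed (rule is_abelian_group)

lemma gns_null_smult: "a \<in> gns_null A \<phi> \<Longrightarrow> c \<odot> a \<in> gns_null A \<phi>"
  by (simp add: gns_null_iff gns.seminorm_smult)

abbreviation gns_coset :: "'a \<Rightarrow> 'a set" where
  "gns_coset a \<equiv> gns_null A \<phi> +> a"

lemma gns_coset_some: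
  assumes "a \<in> carrier A"
  shows "(SOME b. b \<in> gns_coset a) \<in> carrier A"
    and "gns.seminorm ((SOME b. b \<in> gns_coset a) \<ominus> a) = 0"
proof -
  interpret N: abelian_subgroup "gns_null A \<phi>" A by (rule abelian_subgroup_gns_null)
  have *: "(SOME b. b \<in> gns_coset a) \<in> gns_coset a"
    unfolding some_in_eq using N.a_rcos_self[OF assms] by blast
  then show *: "(SOME b. b \<in> gns_coset a) \<in> carrier A"
    using N.a_elemrcos_carrier[OF assms] by blast
  then show "gns.seminorm ((SOME b. b \<in> gns_coset a) \<ominus> a) = 0"
    using \<open>_ \<in> gns_coset a\<close> N.a_rcos_module_minus[OF ring_axioms assms *]
    by (simp add: gns_null_iff)
qed

lemma
  shows carrier_gns_quotient: "carrier (gns_quotient A \<phi>) = gns_coset ` carrier A"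
    and gns_quotient_add: "\<lbrakk>a \<in> carrier A; b \<in> carrier A\<rbrakk> \<Longrightarrow>
      gns_coset a \<oplus>\<^bsub>gns_quotient A \<phi>\<^esub> gns_coset b = gns_coset (a \<oplus> b)"
    and gns_quotient_smult: "a \<in> carrier A \<Longrightarrow>
      c \<odot>\<^bsub>gns_quotient A \<phi>\<^esub> gns_coset a = gns_coset (c \<odot> a)"
    and gns_quotient_cinner: "\<lbrakk>a \<in> carrier A; b \<in> carrier A\<rbrakk> \<Longrightarrow>
      cinner (gns_quotient A \<phi>) (gns_coset a) (gns_coset b) = \<phi> (star A a \<otimes> b)"
    and pre_hilbert_gns_quotient: "pre_hilbert (gns_quotient A \<phi>)"
proof -
  interpret N: abelian_subgroup "gns_null A \<phi>" A by (rule abelian_subgroup_gns_null)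
  show carrier: "carrier (gns_quotient A \<phi>) = gns_coset ` carrier A"
    by (auto simp: gns_quotient_def A_RCOSETS_def')
  show add: "gns_coset a \<oplus>\<^bsub>gns_quotient A \<phi>\<^esub> gns_coset b = gns_coset (a \<oplus> b)"
    if "a \<in> carrier A" "b \<in> carrier A" for a b
    using that by (simp add: gns_quotient_def N.a_rcos_sum)
  show smult: "c \<odot>\<^bsub>gns_quotient A \<phi>\<^esub> gns_coset a = gns_coset (c \<odot> a)"
    if "a \<in> carrier A" for a c
    using that by (simp add: gns_quotient_def coset_smult_rcos[OF abelian_subgroup_gns_null]
        gns_null_smult)
  show cinner: "cinner (gns_quotient A \<phi>) (gns_coset a) (gns_coset b) = \<phi> (star A a \<otimes> b)"
    if "a \<in> carrier A" "b \<in> carrier A" for a b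
    using gns.ip_null[OF gns_coset_some(1)[OF that(1)] gns_coset_some(1)[OF that(2)] that
        gns_coset_some(2)[OF that(1)] gns_coset_some(2)[OF that(2)]]
    by (simp add: gns_quotient_def)
  show "pre_hilbert (gns_quotient A \<phi>)"
  proof (rule gns.pre_hilbert_quotient[where q = gns_coset])
    have zero: "\<zero>\<^bsub>gns_quotient A \<phi>\<^esub> = gns_null A \<phi>"
      by (simp add: gns_quotient_def)
    show "gns_coset \<zero> = \<zero>\<^bsub>gns_quotient A \<phi>\<^esub>"
      unfolding zero using N.a_subset by simp
    show "gns_coset a = \<zero>\<^bsub>gns_quotient A \<phi>\<^esub>" if "a \<in> carrier A" "\<phi> (star A a \<otimes> a) = 0" for a
    proof -
      have "a \<in> gns_null A \<phi>" unfolding gns_null_def using that by blast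
      then show ?thesis unfolding zero by (rule N.a_rcos_const)
    qed
  qed (fact carrier add smult cinner)+
qed

lemma gns_quotient_seminorm_diff:
  assumes "a \<in> carrier A" "b \<in> carrier A"
  shows "semi_inner_product.seminorm (cinner (gns_quotient A \<phi>))
      (gns_coset a \<ominus>\<^bsub>gns_quotient A \<phi>\<^esub> gns_coset b) = gns.seminorm (a \<ominus> b)"
proof -
  interpret V: pre_hilbert "gns_quotient A \<phi>" by (rule pre_hilbert_gns_quotient)
  have in_V: "gns_coset x \<in> carrier (gns_quotient A \<phi>)" if "x \<in> carrier A" for x
    using that by (simp add: carrier_gns_quotient)
  have "gns_coset a \<ominus>\<^bsub>gns_quotient A \<phi>\<^esub> gns_coset b = gns_coset (a \<ominus> b)"
    using assms by (simp add: a_minus_def V.minus_eq_smult in_V gns.minus_eq_smult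
        gns_quotient_add gns_quotient_smult)
  then show ?thesis
    using assms by (simp add: V.seminorm_def gns.seminorm_def gns_quotient_cinner)
qed

text \<open>The unit vector is the sum of the classes of \<open>\<one> \<ominus> u n\<close> and of
  \<open>u n\<close>. The first is a limit of images of \<open>I\<close>, hence lies in
  \<open>gns_ideal\<close>; by \<open>orth\<close> the second is orthogonal to it. Uniqueness of the
  decomposition makes the class of \<open>u\<close> the vector that defines the conditional measure.
  All hypotheses live in \<open>A\<close>, which hides the completion from later arguments.\<close>

lemma conditional_measure_LIMSEQ:
  assumes I: "I \<subseteq> carrier A" and u: "\<And>n. u n \<in> carrier A"
    and cauchy: "\<And>e. 0 < e \<Longrightarrow> \<exists>N. \<forall>n n'. N \<le> n \<longrightarrow> N \<le> n' \<longrightarrow> gns.seminorm (u n \<ominus> u n') < e"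
    and one_minus: "\<And>n. \<one> \<ominus> u n \<in> I"
    and orth: "\<And>g. g \<in> I \<Longrightarrow> (\<lambda>n. \<phi> (star A g \<otimes> u n)) \<longlonglongrightarrow> 0"
    and a: "a \<in> carrier A" "a = (SOME a. a \<in> C)"
  shows "(\<lambda>n. \<phi> (star A (u n) \<otimes> a)) \<longlonglongrightarrow> conditional_measure A \<phi> I C"
proof -
  define V where "V = gns_quotient A \<phi>"
  interpret V: pre_hilbert V unfolding V_def by (rule pre_hilbert_gns_quotient)
  interpret H: pre_hilbert "completion V" by (rule V.pre_hilbert_completion)
  define s where "s = (\<lambda>n. gns_coset (u n))"
  define t where "t = (\<lambda>n. gns_coset (\<one> \<ominus> u n))"
  have in_V: "gns_coset x \<in> carrier V" if "x \<in> carrier A" for x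
    using that by (simp add: V_def carrier_gns_quotient)
  note diff = gns_quotient_seminorm_diff[folded V_def]
  have s: "s \<in> cauchy_seqs V"
  proof (rule V.cauchy_seqsI)
    show "s n \<in> carrier V" for n by (simp add: s_def in_V u)
    show "\<exists>N. \<forall>n n'. N \<le> n \<longrightarrow> N \<le> n' \<longrightarrow> V.seminorm (s n \<ominus>\<^bsub>V\<^esub> s n') < e" if "0 < e" for e
      using cauchy[OF that] by (simp only: s_def diff u)
  qed
  \<comment> \<open>The constant unit cancels in differences, so \<open>t\<close> inherits the
    Cauchy property from \<open>u\<close>.\<close>
  have "(\<one> \<ominus> u n) \<ominus> (\<one> \<ominus> u n') = u n' \<ominus> u n" for n n'
    using u[of n] u[of n'] a_lcomm[of \<one> "u n'" "\<ominus> \<one> \<oplus> \<ominus> u n"]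
    by (simp add: a_minus_def minus_add a_ac r_neg2)
  then have t_diff: "V.seminorm (t n \<ominus>\<^bsub>V\<^esub> t n') = gns.seminorm (u n \<ominus> u n')" for n n'
    using u gns.seminorm_diff_commute[of "u n" "u n'"] by (simp add: t_def diff)
  have t: "t \<in> cauchy_seqs V"
  proof (rule V.cauchy_seqsI)
    show "t n \<in> carrier V" for n by (simp add: t_def in_V u)
    show "\<exists>N. \<forall>n n'. N \<le> n \<longrightarrow> N \<le> n' \<longrightarrow> V.seminorm (t n \<ominus>\<^bsub>V\<^esub> t n') < e" if "0 < e" for e
      using cauchy[OF that] by (simp only: t_diff)
  qed
  have c: "(\<lambda>n. gns_coset x) \<in> cauchy_seqs V" if "x \<in> carrier A" for x
    using that by (simp add: V.cauchy_seqs_const in_V)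
  have gns_vec: "gns_vec A \<phi> x = V.cls (\<lambda>n. gns_coset x)" for x
    by (simp add: gns_vec_def completion_embed_def V_def)
  have gns_ideal: "gns_ideal A \<phi> I =
      cinner_topology (completion V) closure_of (completion_embed V ` gns_coset ` I)"
    by (simp add: gns_ideal_def gns_space_def gns_vec_def V_def image_image)
  have "t n \<oplus>\<^bsub>V\<^esub> s n = gns_coset \<one>" for n
    using u[of n] by (simp add: s_def t_def V_def gns_quotient_add a_minus_def a_assoc l_neg)
  then have sum: "V.cls t \<oplus>\<^bsub>completion V\<^esub> V.cls s = gns_vec A \<phi> \<one>"
    by (simp add: V.completion_add s t gns_vec) (simp add: cauchy_space_def)
  have cls_t: "V.cls t \<in> gns_ideal A \<phi> I"
    unfolding gns_ideal using I one_minus in_V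
    by (intro V.cls_in_closure t) (auto simp: t_def)
  have cls_s: "V.cls s \<in> orth_complement (completion V) (gns_ideal A \<phi> I)"
    unfolding gns_ideal
  proof (rule H.orth_complement_closure)
    show "V.cls s \<in> carrier (completion V)" using s by (simp add: V.carrier_completion)
    show "completion_embed V ` gns_coset ` I \<subseteq> carrier (completion V)"
      using I in_V V.completion_embed_in by blast
    fix x assume "x \<in> completion_embed V ` gns_coset ` I"
    then obtain g where g: "g \<in> I" and x: "x = V.cls (\<lambda>n. gns_coset g)"
      by (auto simp: completion_embed_def)
    have "g \<in> carrier A" using g I by blast
    then show "cinner (completion V) x (V.cls s) = 0"
      unfolding x using s c orth[OF g] u
      by (simp add: V.completion_cinner)
        (intro V.cauchy_ip_eqI, auto simp: s_def V_def gns_quotient_cinner)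
  qed
  interpret M: Metric_space "carrier (completion V)" "cinner_dist (completion V)"
    by (rule H.Metric_space_cinner_dist)
  have "gns_ideal A \<phi> I \<subseteq> carrier (completion V)"
    unfolding gns_ideal cinner_topology_def M.metric_closure_of by blast
  then have "orth_component (completion V) (gns_ideal A \<phi> I) (gns_vec A \<phi> \<one>) = V.cls s"
    using H.orth_component_eq[OF _ cls_t cls_s] by (simp add: sum)
  then have "conditional_measure A \<phi> I C = cauchy_ip V s (\<lambda>n. gns_coset a)"
    using s c[OF a(1)]
    by (simp add: conditional_measure_def gns_space_def V_def[symmetric] a(2)[symmetric] gns_vec
        V.completion_cinner)
  then show ?thesis
    using V.cauchy_ip_LIMSEQ[OF s c[OF a(1)]] u a(1)
    by (simp add: s_def V_def gns_quotient_cinner)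
qed

end

section \<open>Algebras of continuous functions\<close>

lemma continuous_functions_simps [simp]:
  "mult (continuous_functions X) f g = (\<lambda>x\<in>topspace X. f x * g x)"
  "one (continuous_functions X) = (\<lambda>x\<in>topspace X. 1)"
  "zero (continuous_functions X) = (\<lambda>x\<in>topspace X. 0)"
  "add (continuous_functions X) f g = (\<lambda>x\<in>topspace X. f x + g x)"
  "smult (continuous_functions X) c f = (\<lambda>x\<in>topspace X. c * f x)"
  "star (continuous_functions X) f = (\<lambda>x\<in>topspace X. cnj (f x))"
  by (simp_all add: continuous_functions_def)

lemma carrier_continuous_functions:
  "f \<in> carrier (continuous_functions X) \<longleftrightarrow>
    f \<in> extensional (topspace X) \<and> continuous_map X euclidean f"
  by (simp add: continuous_functions_def)

lemma continuous_functionsD: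
  "f \<in> carrier (continuous_functions X) \<Longrightarrow> continuous_map X euclidean f"
  by (simp add: carrier_continuous_functions)

lemma continuous_functions_ext:
  assumes "f \<in> carrier (continuous_functions X)" "g \<in> carrier (continuous_functions X)"
    and "\<And>x. x \<in> topspace X \<Longrightarrow> f x = g x"
  shows "f = g"
  using assms unfolding carrier_continuous_functions by (blast intro: extensionalityI)

lemma restrict_continuous_functions:
  assumes "continuous_map X euclidean f"
  shows "restrict f (topspace X) \<in> carrier (continuous_functions X)"
  using continuous_map_eq[OF assms, of "restrict f (topspace X)"]
  by (simp add: carrier_continuous_functions)

lemma continuous_map_mult:
  fixes f :: "'a \<Rightarrow> 'b::real_normed_algebra"
  shows "\<lbrakk>continuous_map X euclidean f; continuous_map X euclidean g\<rbrakk>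
    \<Longrightarrow> continuous_map X euclidean (\<lambda>x. f x * g x)"
  by (simp add: continuous_map_atin tendsto_mult)

lemma continuous_map_cnj:
  "continuous_map X euclidean f \<Longrightarrow> continuous_map X euclidean (\<lambda>x. cnj (f x))"
  by (simp add: continuous_map_atin tendsto_cnj)

lemma continuous_map_compose_UNIV:
  assumes "continuous_map X euclidean f" "continuous_on UNIV g"
  shows "continuous_map X euclidean (\<lambda>x. g (f x))"
  using continuous_map_compose[OF assms(1), of euclidean g] assms(2) by (simp add: o_def)

lemma star_algebra_continuous_functions: "star_algebra (continuous_functions X)"
proof -
  let ?C = "continuous_functions X"
  have closed: "f \<oplus>\<^bsub>?C\<^esub> g \<in> carrier ?C" "f \<otimes>\<^bsub>?C\<^esub> g \<in> carrier ?C" "c \<odot>\<^bsub>?C\<^esub> f \<in> carrier ?C"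
    "star ?C f \<in> carrier ?C" "\<one>\<^bsub>?C\<^esub> \<in> carrier ?C" "\<zero>\<^bsub>?C\<^esub> \<in> carrier ?C"
    if "f \<in> carrier ?C" "g \<in> carrier ?C" for f g c
    using that continuous_functionsD[of f] continuous_functionsD[of g]
    by (auto intro!: restrict_continuous_functions continuous_map_add continuous_map_mult
        continuous_map_cnj)
  have zero: "\<zero>\<^bsub>?C\<^esub> \<in> carrier ?C" and one: "\<one>\<^bsub>?C\<^esub> \<in> carrier ?C"
    by (auto intro!: restrict_continuous_functions)
  \<comment> \<open>Unit laws produce \<open>restrict f (topspace X)\<close>; extensionality of the
    carrier turns this back into \<open>f\<close>.\<close>
  have restr: "restrict f (topspace X) = f" if "f \<in> carrier ?C" for f
    using that by (simp add: carrier_continuous_functions extensional_restrict)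
  have group: "abelian_group ?C"
  proof (rule abelian_groupI)
    fix f assume f: "f \<in> carrier ?C"
    show "\<exists>g\<in>carrier ?C. g \<oplus>\<^bsub>?C\<^esub> f = \<zero>\<^bsub>?C\<^esub>"
      by (rule bexI[OF _ closed(3)[OF f f, of "-1"]]) (auto intro!: restrict_ext)
  qed (use closed zero in \<open>auto simp: restr algebra_simps cong: restrict_cong\<close>)
  have "monoid ?C"
    by (rule monoidI) (use closed one in \<open>auto simp: restr algebra_simps cong: restrict_cong\<close>)
  with group have ring: "ring ?C"
    by (rule ringI) (auto simp: algebra_simps cong: restrict_cong)
  have "module complex_ring ?C"
    by (rule moduleI[OF cring_complex_ring group])
      (use closed in \<open>auto simp: restr algebra_simps cong: restrict_cong\<close>)
  then show ?thesis
    using ring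
    by (rule star_algebra.intro, unfold_locales)
      (use closed in \<open>auto simp: restr algebra_simps cong: restrict_cong\<close>)
qed

lemma continuous_functions_minus:
  assumes "f \<in> carrier (continuous_functions X)" "g \<in> carrier (continuous_functions X)"
  shows "f \<ominus>\<^bsub>continuous_functions X\<^esub> g = (\<lambda>x\<in>topspace X. f x - g x)"
proof -
  interpret star_algebra "continuous_functions X" by (rule star_algebra_continuous_functions)
  have "(\<lambda>x\<in>topspace X. - g x) \<in> carrier (continuous_functions X)"
    using continuous_functionsD[OF assms(2)] by (intro restrict_continuous_functions) simp
  then have "\<ominus>\<^bsub>continuous_functions X\<^esub> g = (\<lambda>x\<in>topspace X. - g x)"
    using assms(2) by (intro minus_equality) (auto cong: restrict_cong)
  then show ?thesis by (simp add: a_minus_def cong: restrict_cong)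
qed

section \<open>Integration of continuous functions on a compact space\<close>

lemma continuous_map_bounded:
  fixes f :: "'x \<Rightarrow> 'b::real_normed_vector"
  assumes "compact_space X" "continuous_map X euclidean f"
  obtains M where "0 < M" "\<And>x. x \<in> topspace X \<Longrightarrow> norm (f x) \<le> M"
proof -
  have "compactin euclidean (f ` topspace X)"
    using assms image_compactin[of X "topspace X" euclidean f] by (simp add: compact_space_def)
  then have "bounded (f ` topspace X)" by (simp add: compact_imp_bounded)
  then show thesis using that by (auto simp: bounded_pos)
qed

text \<open>Formulated with measurability of open sets, so that it applies both to
  \<open>\<mu>\<close> on \<open>X\<close> and to \<open>restrict_space \<mu> B\<close> on the
  subspace.\<close>

lemma integrable_continuous_map:
  fixes f :: "'x \<Rightarrow> 'b::{banach, second_countable_topology}"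
  assumes "finite_measure M" "space M = topspace X" "\<And>U. openin X U \<Longrightarrow> U \<in> sets M"
    and "compact_space X" "continuous_map X euclidean f"
  shows "integrable M f"
proof -
  interpret finite_measure M by fact
  have "f -` U \<inter> space M \<in> sets M" if "open U" for U
    using openin_continuous_map_preimage[OF assms(5), of U] assms(2,3) that
    by (simp add: vimage_def Int_def conj_commute)
  then have "f \<in> borel_measurable M" by (rule borel_measurableI)
  moreover obtain C where "\<And>x. x \<in> topspace X \<Longrightarrow> norm (f x) \<le> C"
    using continuous_map_bounded[OF assms(4,5)] by blast
  ultimately show ?thesis
    by (intro integrable_const_bound[of f C]) (auto simp: assms(2))
qed

lemma integral_functional_restrict:
  "space M = topspace X \<Longrightarrow> integral_functional M (\<lambda>x\<in>topspace X. f x) = (\<integral>x. f x \<partial>M)"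
  unfolding integral_functional_def by (rule Bochner_Integration.integral_cong) auto

lemma quantum_measure_space_continuous_functions:
  assumes "finite_measure M" "space M = topspace X" "\<And>U. openin X U \<Longrightarrow> U \<in> sets M"
    and "compact_space X"
  shows "quantum_measure_space (continuous_functions X) (integral_functional M)"
proof -
  interpret star_algebra "continuous_functions X" by (rule star_algebra_continuous_functions)
  note integrable = integrable_continuous_map[OF assms continuous_functionsD]
    and restrict = integral_functional_restrict[OF assms(2)]
  show ?thesis
  proof (unfold_locales, goal_cases)
    case (1 f g)
    then show ?case
      by (simp add: restrict) (simp add: integrable integral_functional_def)
  next
    case (2 f c)
    then show ?case
      by (simp add: restrict) (simp add: integral_functional_def)
  next
    case (3 f)
    then obtain a where "a \<in> carrier (continuous_functions X)"
      and f: "f = (\<lambda>x\<in>topspace X. (\<lambda>x\<in>topspace X. cnj (a x)) x * a x)"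
      by (auto simp: positive_elements_def)
    then have "integral_functional M f = (\<integral>x. complex_of_real ((cmod (a x))\<^sup>2) \<partial>M)"
      unfolding integral_functional_def f
      by (intro Bochner_Integration.integral_cong)
        (simp_all add: assms(2) complex_norm_square[unfolded of_real_power])
    also have "\<dots> = complex_of_real (\<integral>x. (cmod (a x))\<^sup>2 \<partial>M)"
      by (rule integral_complex_of_real)
    finally show ?case by (simp add: complex_nonneg_Reals_iff)
  qed
qed

section \<open>Extension from closed sets, and ideals determined by their common zeros\<close>

text \<open>Tietze's theorem is applied to the real and the imaginary part separately, with the
  whole line as target interval.\<close>

lemma continuous_functions_extension:
  assumes "normal_space X" "closedin X B" "f \<in> carrier (continuous_functions (subtopology X B))"
  obtains g where "g \<in> carrier (continuous_functions X)" "restrict g B = f"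
proof -
  have B: "B \<subseteq> topspace X" "topspace (subtopology X B) = B"
    using closedin_subset[OF assms(2)] by auto
  have f: "continuous_map (subtopology X B) euclidean f" "f \<in> extensional B"
    using assms(3) B by (auto simp: carrier_continuous_functions)
  have "continuous_map (subtopology X B) euclideanreal (\<lambda>x. Re (f x))"
    by (rule continuous_map_compose_UNIV[OF f(1)]) (intro continuous_intros)
  then obtain u where u: "continuous_map X euclideanreal u" "\<And>x. x \<in> B \<Longrightarrow> u x = Re (f x)"
    using Tietze_extension_realinterval[OF assms(1,2) is_interval_univ UNIV_not_empty] by auto
  have "continuous_map (subtopology X B) euclideanreal (\<lambda>x. Im (f x))"
    by (rule continuous_map_compose_UNIV[OF f(1)]) (intro continuous_intros)
  then obtain v where v: "continuous_map X euclideanreal v" "\<And>x. x \<in> B \<Longrightarrow> v x = Im (f x)"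
    using Tietze_extension_realinterval[OF assms(1,2) is_interval_univ UNIV_not_empty] by auto
  have "continuous_map X euclidean (\<lambda>x. complex_of_real (u x) + \<i> * complex_of_real (v x))"
    using u(1) v(1)
    by (intro continuous_map_add continuous_map_mult)
      (auto intro!: continuous_map_compose_UNIV[of _ _ complex_of_real] continuous_intros)
  from restrict_continuous_functions[OF this]
  show thesis
  proof (rule that)
    show "restrict (\<lambda>x\<in>topspace X. complex_of_real (u x) + \<i> * complex_of_real (v x)) B = f"
    proof (rule extensionalityI[OF _ f(2)])
      fix x assume "x \<in> B"
      then show "restrict (\<lambda>x\<in>topspace X. complex_of_real (u x) + \<i> * complex_of_real (v x)) B x = f x"
        using B(1) u(2) v(2) complex_eq[of "f x"] by auto
    qed (rule restrict_extensional)
  qed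
qed

text \<open>On the compact set where \<open>cmod (f x) \<ge> e\<close>, finitely many members of
  \<open>J\<close> have no common zero, so the sum \<open>k\<close> of their squared moduli is
  bounded below there. Then \<open>f * n * k / (1 + n * k)\<close> lies in \<open>J\<close> and
  approximates \<open>f\<close>.\<close>

lemma uniformly_closed_ideal_vanishing:
  assumes "compact_space X" and "ideal J (continuous_functions X)"
    and closed: "\<And>f. \<lbrakk>f \<in> carrier (continuous_functions X);
      \<And>e. 0 < e \<Longrightarrow> \<exists>h\<in>J. \<forall>x\<in>topspace X. cmod (f x - h x) < e\<rbrakk> \<Longrightarrow> f \<in> J"
    and f: "f \<in> carrier (continuous_functions X)"
    and zero: "\<And>x. \<lbrakk>x \<in> topspace X; \<And>h. h \<in> J \<Longrightarrow> h x = 0\<rbrakk> \<Longrightarrow> f x = 0"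
  shows "f \<in> J"
proof (rule closed[OF f])
  fix e :: real assume e: "0 < e"
  let ?C = "continuous_functions X"
  interpret C: star_algebra ?C by (rule star_algebra_continuous_functions)
  interpret J: ideal J ?C by fact
  define K where "K = {x \<in> topspace X. cmod (f x) \<in> {e..}}"
  have "closedin X K"
    unfolding K_def using continuous_functionsD[OF f]
    by (intro closedin_continuous_map_preimage[where Y = euclidean] continuous_map_norm) auto
  then have K: "compactin X K"
    by (rule closedin_compact_space[OF assms(1)])
  define U where "U h = {x \<in> topspace X. h x \<in> - {0::complex}}" for h :: "'a \<Rightarrow> complex"
  have "\<forall>V\<in>U ` J. openin X V"
    using openin_continuous_map_preimage[OF continuous_functionsD[OF J.a_Hcarr], of _ "- {0}"]
    by (auto simp: U_def)
  \<comment> \<open>If all of \<open>J\<close> vanished at a point of \<open>K\<close>, then so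
    would \<open>f\<close> by \<open>zero\<close>, against
    \<open>cmod (f x) \<ge> e\<close>.\<close>
  moreover have "K \<subseteq> \<Union>(U ` J)"
    unfolding K_def U_def using zero e by fastforce
  ultimately obtain \<F> where "finite \<F>" "\<F> \<subseteq> U ` J" "K \<subseteq> \<Union>\<F>"
    using K unfolding compactin_def by meson
  then obtain F where F: "finite F" "F \<subseteq> J" and KF: "K \<subseteq> \<Union>(U ` F)"
    by (metis finite_subset_image)
  \<comment> \<open>The sum of \<open>star h \<otimes> h\<close> over \<open>F\<close>: it stays in
    the ideal and vanishes only at common zeros of \<open>F\<close>, hence nowhere on
    \<open>K\<close>.\<close>
  define k where "k x = (\<Sum>h\<in>F. (cmod (h x))\<^sup>2)" for x
  have k_nonneg: "0 \<le> k x" for x by (simp add: k_def sum_nonneg)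
  have k_J: "(\<lambda>x\<in>topspace X. complex_of_real (k x)) \<in> J"
    unfolding k_def using F
  proof (induction F)
    case empty
    then show ?case using J.zero_closed by (simp add: restrict_def)
  next
    case (insert h F)
    then have h: "h \<in> J" "h \<in> carrier ?C" using J.a_Hcarr by auto
    then have "star ?C h \<otimes>\<^bsub>?C\<^esub> h \<in> J"
      using J.I_l_closed C.star_closed by blast
    moreover have "(\<lambda>x\<in>topspace X. complex_of_real (\<Sum>h\<in>F. (cmod (h x))\<^sup>2)) \<in> J"
      using insert.IH insert.prems by blast
    ultimately have "(star ?C h \<otimes>\<^bsub>?C\<^esub> h) \<oplus>\<^bsub>?C\<^esub>
        (\<lambda>x\<in>topspace X. complex_of_real (\<Sum>h\<in>F. (cmod (h x))\<^sup>2)) \<in> J"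
      by (rule J.a_closed)
    also have "(star ?C h \<otimes>\<^bsub>?C\<^esub> h) \<oplus>\<^bsub>?C\<^esub>
        (\<lambda>x\<in>topspace X. complex_of_real (\<Sum>h\<in>F. (cmod (h x))\<^sup>2)) =
        (\<lambda>x\<in>topspace X. complex_of_real (\<Sum>h\<in>insert h F. (cmod (h x))\<^sup>2))"
      using insert(1,2)
      by (auto simp: complex_norm_square[unfolded of_real_power] mult.commute intro!: restrict_ext)
    finally show ?case .
  qed
  then have "continuous_map X euclidean (\<lambda>x\<in>topspace X. complex_of_real (k x))"
    using J.a_Hcarr continuous_functionsD by blast
  then have k_contc: "continuous_map X euclidean (\<lambda>x. complex_of_real (k x))"
    by (rule continuous_map_eq) simp
  then have k_cont: "continuous_map X euclideanreal k"
    using continuous_map_compose_UNIV[OF k_contc, of Re] continuous_on_Re[OF continuous_on_id, of UNIV]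
    by simp
  have k_pos: "0 < k x" if x: "x \<in> K" for x
  proof -
    obtain h where "h \<in> F" "h x \<noteq> 0" using KF x by (auto simp: U_def)
    then have "0 < (cmod (h x))\<^sup>2" and "(cmod (h x))\<^sup>2 \<le> k x"
      unfolding k_def using F by (auto intro: member_le_sum)
    then show ?thesis by linarith
  qed
  obtain d where d: "0 < d" "\<And>x. x \<in> K \<Longrightarrow> d \<le> k x"
  proof (cases "K = {}")
    case True
    then show thesis using that[of 1] by simp
  next
    case False
    have "compactin euclideanreal (k ` K)" by (rule image_compactin[OF K k_cont])
    then obtain x where "x \<in> K" "\<forall>y\<in>K. k x \<le> k y"
      using compact_attains_inf[of "k ` K"] False by auto
    then show thesis using that[of "k x"] k_pos by blast
  qed
  obtain M where M: "0 < M" "\<And>x. x \<in> topspace X \<Longrightarrow> cmod (f x) \<le> M"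
    using continuous_map_bounded[OF assms(1) continuous_functionsD[OF f]] by blast
  \<comment> \<open>Chosen such that \<open>e * (n * d) = M\<close>, which pushes
    \<open>cmod (f x) / (1 + n * k x)\<close> below \<open>e\<close> on \<open>K\<close>.\<close>
  define n where "n = M / (e * d)"
  have n: "0 < n" using M d e by (simp add: n_def)
  have pos: "0 < 1 + n * k x" for x
    using n k_nonneg[of x] by (simp add: add_pos_nonneg)
  \<comment> \<open>The error of \<open>p * k\<close> is \<open>f / (1 + n * k)\<close>: small on
    \<open>K\<close> by the choice of \<open>n\<close>, and off \<open>K\<close> already below
    \<open>e\<close> because \<open>f\<close> is.\<close>
  define p where "p = (\<lambda>x\<in>topspace X. f x * complex_of_real (n / (1 + n * k x)))"
  have "p \<in> carrier ?C"
    unfolding p_def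
  proof (intro restrict_continuous_functions continuous_map_mult continuous_functionsD[OF f])
    \<comment> \<open>\<open>k\<close> takes values in this half-line, on which the denominator has
      no zero.\<close>
    have "continuous_on {0..} (\<lambda>t. complex_of_real (n / (1 + n * t)))"
      using n by (intro continuous_intros) (auto simp: add_nonneg_eq_0_iff)
    moreover have "continuous_map X (top_of_set {0..}) k"
      using k_cont k_nonneg by (auto simp: continuous_map_in_subtopology)
    ultimately show "continuous_map X euclidean (\<lambda>x. complex_of_real (n / (1 + n * k x)))"
      using continuous_map_compose[of X "top_of_set {0..}" k euclidean] by (auto simp: o_def)
  qed
  then have "p \<otimes>\<^bsub>?C\<^esub> (\<lambda>x\<in>topspace X. complex_of_real (k x)) \<in> J"
    by (rule J.I_l_closed[OF k_J])
  moreover have "cmod (f x - (p \<otimes>\<^bsub>?C\<^esub> (\<lambda>x\<in>topspace X. complex_of_real (k x))) x) < e"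
    if x: "x \<in> topspace X" for x
  proof -
    have "f x - (p \<otimes>\<^bsub>?C\<^esub> (\<lambda>x\<in>topspace X. complex_of_real (k x))) x =
        f x * complex_of_real (1 - n / (1 + n * k x) * k x)"
      using x by (simp add: p_def algebra_simps)
    also have "1 - n / (1 + n * k x) * k x = 1 / (1 + n * k x)"
      using pos[of x] by (simp add: field_simps)
    finally have "f x - (p \<otimes>\<^bsub>?C\<^esub> (\<lambda>x\<in>topspace X. complex_of_real (k x))) x =
        f x * complex_of_real (1 / (1 + n * k x))" .
    then have "cmod (f x - (p \<otimes>\<^bsub>?C\<^esub> (\<lambda>x\<in>topspace X. complex_of_real (k x))) x) =
        cmod (f x) * \<bar>1 / (1 + n * k x)\<bar>"
      by (simp only: norm_mult norm_of_real)
    also have "\<dots> = cmod (f x) / (1 + n * k x)"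
      using pos[of x] by simp
    finally have eq: "cmod (f x - (p \<otimes>\<^bsub>?C\<^esub> (\<lambda>x\<in>topspace X. complex_of_real (k x))) x) =
        cmod (f x) / (1 + n * k x)" .
    show ?thesis
    proof (cases "x \<in> K")
      case True
      have "cmod (f x) \<le> M" using M x by simp
      also have "M = e * (n * d)" using e d by (simp add: n_def)
      also have "\<dots> \<le> e * (n * k x)" using e n d(2)[OF True] by simp
      also have "\<dots> < e * (1 + n * k x)" using e by simp
      finally show ?thesis unfolding eq using pos[of x] by (simp add: pos_divide_less_eq)
    next
      case False
      then have "cmod (f x) < e" using x by (simp add: K_def)
      moreover have "cmod (f x) / (1 + n * k x) \<le> cmod (f x) / 1"
        using n k_nonneg[of x] pos[of x] by (intro divide_left_mono) auto
      ultimately show ?thesis unfolding eq by simp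
    qed
  qed
  ultimately show "\<exists>h\<in>J. \<forall>x\<in>topspace X. cmod (f x - h x) < e" by blast
qed

section \<open>Closed ideals of commutative C*-algebras\<close>

context c_star_algebra
begin

section \<open>Norm bounds for star-homomorphisms from \<open>C(X)\<close>\<close>

context
  fixes X :: "'x topology" and g :: "('x \<Rightarrow> complex) \<Rightarrow> 'a"
  assumes hom: "g \<in> ring_hom (continuous_functions X) A"
    and smult: "\<And>c f. f \<in> carrier (continuous_functions X) \<Longrightarrow>
      g (c \<odot>\<^bsub>continuous_functions X\<^esub> f) = c \<odot> g f"
    and star: "\<And>f. f \<in> carrier (continuous_functions X) \<Longrightarrow>
      g (star (continuous_functions X) f) = star A (g f)"
begin

interpretation C: star_algebra "continuous_functions X"
  by (rule star_algebra_continuous_functions)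

interpretation g: ring_hom_ring "continuous_functions X" A g
  by (rule ring_hom_ringI2[OF C.ring_axioms ring_axioms hom])

text \<open>By the C*-identity the squared norm of \<open>g u\<close> is the norm of the image of
  \<open>star u \<otimes> u\<close>, that is, of \<open>g\<close> at the unit. The unit is itself
  such a function, which fixes that norm.\<close>

lemma nrm_hom_unitary:
  assumes u: "u \<in> carrier (continuous_functions X)" "\<And>x. x \<in> topspace X \<Longrightarrow> cmod (u x) = 1"
  shows "nrm (g u) \<le> 1"
proof -
  let ?C = "continuous_functions X"
  have sq: "(nrm (g v))\<^sup>2 = nrm (g \<one>\<^bsub>?C\<^esub>)"
    if v: "v \<in> carrier ?C" "\<And>x. x \<in> topspace X \<Longrightarrow> cmod (v x) = 1" for v
  proof -
    have "star ?C v \<otimes>\<^bsub>?C\<^esub> v = \<one>\<^bsub>?C\<^esub>"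
      using v(2) by (auto intro!: restrict_ext
          simp: complex_norm_square[unfolded of_real_power, symmetric] mult.commute)
    moreover have "star A (g v) \<otimes> g v = g (star ?C v \<otimes>\<^bsub>?C\<^esub> v)"
      using v(1) C.star_closed[OF v(1)] ring_hom_mult[OF hom] star by metis
    ultimately show ?thesis
      using nrm_star_mult[of "g v"] v(1) by (metis g.hom_closed)
  qed
  \<comment> \<open>A number equal to its square is 0 or 1; the value 0 belongs to the zero
    algebra.\<close>
  have "(nrm (g \<one>\<^bsub>?C\<^esub>))\<^sup>2 = nrm (g \<one>\<^bsub>?C\<^esub>)"
    by (rule sq[OF C.one_closed]) simp
  then have "nrm (g \<one>\<^bsub>?C\<^esub>) \<le> 1"
    by (auto simp: power2_eq_square)
  then have "(nrm (g u))\<^sup>2 \<le> 1\<^sup>2"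
    using sq[OF u] by simp
  then show ?thesis by (rule power2_le_imp_le) simp
qed

text \<open>A real function \<open>f\<close> with \<open>\<bar>f\<bar> \<le> 1\<close> is the mean of the unitaries
  \<open>f \<plusminus> \<i> sqrt (1 - f\<^sup>2)\<close>.\<close>

lemma nrm_hom_real:
  assumes f: "continuous_map X euclideanreal f" "\<And>x. x \<in> topspace X \<Longrightarrow> \<bar>f x\<bar> \<le> 1"
  shows "nrm (g (\<lambda>x\<in>topspace X. complex_of_real (f x))) \<le> 1"
proof -
  let ?C = "continuous_functions X"
  define u where "u s = (\<lambda>x\<in>topspace X. complex_of_real (f x) +
    s * complex_of_real (sqrt (1 - (f x)\<^sup>2)))" for s
  have u_in: "u s \<in> carrier ?C" for s
    unfolding u_def using f(1)
    by (intro restrict_continuous_functions continuous_map_compose_UNIV[OF f(1)] continuous_intros)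
  have "cmod (u s x) = 1" if "s = \<i> \<or> s = - \<i>" "x \<in> topspace X" for s x
    using that f(2)[of x] by (auto simp: u_def cmod_def abs_square_le_1)
  then have le: "nrm (g (u s)) \<le> 1" if "s = \<i> \<or> s = - \<i>" for s
    using that u_in by (intro nrm_hom_unitary) auto
  have half: "(1/2) \<odot>\<^bsub>?C\<^esub> u s \<in> carrier ?C" for s
    using C.smult_closed[of "1/2" "u s"] u_in by simp
  have "(\<lambda>x\<in>topspace X. complex_of_real (f x)) =
      (1/2) \<odot>\<^bsub>?C\<^esub> u \<i> \<oplus>\<^bsub>?C\<^esub> (1/2) \<odot>\<^bsub>?C\<^esub> u (- \<i>)"
    by (auto simp: u_def field_simps intro!: restrict_ext)
  then have "g (\<lambda>x\<in>topspace X. complex_of_real (f x)) = (1/2) \<odot> g (u \<i>) \<oplus> (1/2) \<odot> g (u (- \<i>))"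
    using half smult[OF u_in] ring_hom_add[OF hom] by metis
  moreover have "(1/2) \<odot> g (u s) \<in> carrier A" for s
    using smult_closed[of "1/2" "g (u s)"] u_in by simp
  ultimately have "nrm (g (\<lambda>x\<in>topspace X. complex_of_real (f x))) \<le>
      nrm ((1/2) \<odot> g (u \<i>)) + nrm ((1/2) \<odot> g (u (- \<i>)))"
    using nrm_triangle by metis
  also have "\<dots> \<le> 1"
    using le[of \<i>] le[of "- \<i>"] u_in by (simp add: nrm_smult)
  finally show ?thesis .
qed

text \<open>Real and imaginary part, divided by \<open>s\<close>, take values in [-1, 1]. Each
  contributes at most \<open>s\<close>, whence the factor 2.\<close>

lemma nrm_hom_le:
  assumes f: "f \<in> carrier (continuous_functions X)" and "0 < s"
    and le: "\<And>x. x \<in> topspace X \<Longrightarrow> cmod (f x) \<le> s"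
  shows "nrm (g f) \<le> 2 * s"
proof -
  let ?C = "continuous_functions X"
  define a where "a = (\<lambda>x\<in>topspace X. complex_of_real (Re (f x) / s))"
  define b where "b = (\<lambda>x\<in>topspace X. complex_of_real (Im (f x) / s))"
  note cont = continuous_functionsD[OF f]
  have c: "continuous_map X euclideanreal (\<lambda>x. Re (f x) / s)"
    "continuous_map X euclideanreal (\<lambda>x. Im (f x) / s)"
    using \<open>0 < s\<close> by (intro continuous_map_compose_UNIV[OF cont] continuous_intros; simp)+
  have in_C: "a \<in> carrier ?C" "b \<in> carrier ?C"
    unfolding a_def b_def
    by (rule restrict_continuous_functions,
        rule continuous_map_compose_UNIV[OF _ continuous_on_of_real[OF continuous_on_id]], rule c)+
  have "\<bar>Re (f x) / s\<bar> \<le> 1 \<and> \<bar>Im (f x) / s\<bar> \<le> 1" if "x \<in> topspace X" for x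
    using le[OF that] \<open>0 < s\<close> abs_Re_le_cmod[of "f x"] abs_Im_le_cmod[of "f x"]
    by (simp add: abs_divide pos_divide_le_eq)
  then have ab: "nrm (g a) \<le> 1" "nrm (g b) \<le> 1"
    unfolding a_def b_def by (blast intro: nrm_hom_real[OF c(1)] nrm_hom_real[OF c(2)])+
  have "f = complex_of_real s \<odot>\<^bsub>?C\<^esub> a \<oplus>\<^bsub>?C\<^esub> (complex_of_real s * \<i>) \<odot>\<^bsub>?C\<^esub> b" (is "_ = ?r")
  proof (rule continuous_functions_ext[OF f])
    show "?r \<in> carrier ?C"
      using C.smult_closed[of "complex_of_real s" a] C.smult_closed[of "complex_of_real s * \<i>" b] in_C
      by (intro C.add.m_closed) simp_all
    show "f x = ?r x" if "x \<in> topspace X" for x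
      using that \<open>0 < s\<close> by (simp add: a_def b_def complex_eq_iff)
  qed
  then have "g f = complex_of_real s \<odot> g a \<oplus> (complex_of_real s * \<i>) \<odot> g b"
    using in_C C.smult_closed[of "complex_of_real s" a] C.smult_closed[of "complex_of_real s * \<i>" b]
      smult ring_hom_add[OF hom] by (metis UNIV_I complex_ring_simps(1))
  moreover have "c \<odot> g a \<in> carrier A" "c \<odot> g b \<in> carrier A" for c
    using smult_closed[of c "g a"] smult_closed[of c "g b"] in_C by simp_all
  ultimately have "nrm (g f) \<le> nrm (complex_of_real s \<odot> g a) + nrm ((complex_of_real s * \<i>) \<odot> g b)"
    using nrm_triangle by metis
  also have "\<dots> = s * nrm (g a) + s * nrm (g b)"
    using in_C \<open>0 < s\<close> by (simp add: nrm_smult norm_mult)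
  also have "\<dots> \<le> s * 1 + s * 1"
    using ab \<open>0 < s\<close> by (intro add_mono mult_left_mono) auto
  finally show ?thesis by simp
qed

text \<open>The norm bound turns uniform approximation of \<open>f\<close> into approximation of
  \<open>g f\<close> in \<open>nrm\<close>, where closedness of \<open>I\<close> applies.\<close>

lemma hom_in_closed:
  assumes I: "closedin (norm_topology A nrm) I"
    and f: "f \<in> carrier (continuous_functions X)"
    and approx: "\<And>e. 0 < e \<Longrightarrow>
      \<exists>h\<in>carrier (continuous_functions X). g h \<in> I \<and> (\<forall>x\<in>topspace X. cmod (f x - h x) < e)"
  shows "g f \<in> I"
proof -
  interpret M: Metric_space "carrier A" "norm_dist A nrm"
    by (rule Metric_space_norm_dist)
  have "\<exists>y\<in>I. y \<in> M.mball (g f) r" if "0 < r" for r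
  proof -
    \<comment> \<open>A uniform error \<open>r / 3\<close> costs at most \<open>2 * (r / 3)\<close>
      in \<open>nrm\<close>, still below \<open>r\<close>.\<close>
    from that have "0 < r / 3" by simp
    then obtain h where h: "h \<in> carrier (continuous_functions X)" "g h \<in> I"
      and less: "\<And>x. x \<in> topspace X \<Longrightarrow> cmod (f x - h x) < r / 3"
      using approx by blast
    have "g f \<ominus> g h = g (f \<ominus>\<^bsub>continuous_functions X\<^esub> h)"
      using f h(1) by (simp add: a_minus_def del: continuous_functions_simps)
    moreover have "nrm (g (f \<ominus>\<^bsub>continuous_functions X\<^esub> h)) \<le> 2 * (r / 3)"
      using C.minus_closed[OF f h(1)] \<open>0 < r\<close> less
      by (intro nrm_hom_le) (auto simp: continuous_functions_minus[OF f h(1)] less_imp_le)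
    ultimately have "norm_dist A nrm (g f) (g h) < r"
      using f h(1) \<open>0 < r\<close> by (simp add: norm_dist_def)
    then show ?thesis using f h(1) by (intro bexI[OF _ h(2)]) simp
  qed
  then have "g f \<in> M.mtopology closure_of I"
    using f by (simp add: M.metric_closure_of)
  then show ?thesis
    using I by (simp add: norm_topology_def closure_of_closedin)
qed

text \<open>The preimage of \<open>I\<close> under \<open>g\<close> is an ideal of
  \<open>C(X)\<close>, uniformly closed by \<open>hom_in_closed\<close>, and so determined by its
  common zeros.\<close>

lemma closed_ideal_vanishing:
  assumes "compact_space X" "ideal I A" "closedin (norm_topology A nrm) I"
    and f: "f \<in> carrier (continuous_functions X)"
    and zero: "\<And>x. \<lbrakk>x \<in> topspace X;
      \<And>h. \<lbrakk>h \<in> carrier (continuous_functions X); g h \<in> I\<rbrakk> \<Longrightarrow> h x = 0\<rbrakk> \<Longrightarrow> f x = 0"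
  shows "g f \<in> I"
proof -
  define J where "J = {h \<in> carrier (continuous_functions X). g h \<in> I}"
  have "f \<in> J"
  proof (rule uniformly_closed_ideal_vanishing[OF assms(1) _ _ f])
    show "ideal J (continuous_functions X)"
      unfolding J_def by (rule g.ideal_vimage[OF assms(2)])
    fix f' assume f': "f' \<in> carrier (continuous_functions X)"
      and "\<And>e. 0 < e \<Longrightarrow> \<exists>h\<in>J. \<forall>x\<in>topspace X. cmod (f' x - h x) < e"
    then have "g f' \<in> I"
      by (intro hom_in_closed[OF assms(3)]) (auto simp: J_def)
    with f' show "f' \<in> J" by (simp add: J_def)
  qed (use zero in \<open>auto simp: J_def\<close>)
  then show ?thesis by (simp add: J_def)
qed

end

end

section \<open>Approximation of indicator functions\<close>

context regular_borel_measure
begin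

lemma openin_sets: "openin X U \<Longrightarrow> U \<in> sets M"
  using sets_eq by auto

lemma closedin_sets:
  assumes "closedin X B"
  shows "B \<in> sets M"
proof -
  have "space M - (topspace X - B) \<in> sets M"
    using assms by (intro sets.compl_sets openin_sets) (simp add: closedin_def)
  then show ?thesis
    using closedin_subset[OF assms] by (simp add: space_eq double_diff)
qed

lemma integrable_continuous:
  fixes f :: "'x \<Rightarrow> 'b::{banach, second_countable_topology}"
  assumes "compact_space X" "continuous_map X euclidean f"
  shows "integrable M f"
  by (rule integrable_continuous_map[OF finite_measure_axioms space_eq _ assms]) (rule openin_sets)

text \<open>A Urysohn function that is 0 outside \<open>U\<close> and 1 on \<open>B\<close> differs
  from the indicator only on \<open>U - B\<close>, and there by at most 1. So the integral is
  controlled by the measure of \<open>U - B\<close>.\<close>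

lemma indicator_approximation:
  assumes "compact_space X" "Hausdorff_space X" and B: "closedin X B" and "0 < e"
  obtains u where "continuous_map X euclideanreal u"
    "\<And>x. x \<in> topspace X \<Longrightarrow> u x \<in> {0..1}" "\<And>x. x \<in> B \<Longrightarrow> u x = 1"
    "(\<integral>x. \<bar>u x - indicator B x\<bar> \<partial>M) \<le> e"
proof -
  note B_sets = closedin_sets[OF B]
  \<comment> \<open>Strict because the measure is finite; hence the infimum in outer regularity is
    undercut by some \<open>U\<close>.\<close>
  have "emeasure M B < emeasure M B + ennreal e"
    using \<open>0 < e\<close> by (simp add: emeasure_eq_measure ennreal_plus[symmetric] ennreal_less_iff del: ennreal_plus)
  then obtain U where U: "openin X U" "B \<subseteq> U" and less: "emeasure M U < emeasure M B + ennreal e"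
    using outer_regular[OF B_sets] by (auto simp: INF_less_iff)
  then have "measure M U < measure M B + e"
    using \<open>0 < e\<close> by (simp add: emeasure_eq_measure ennreal_plus[symmetric] ennreal_less_iff del: ennreal_plus)
  then have diff: "measure M (U - B) \<le> e"
    using U openin_sets B_sets by (simp add: finite_measure_Diff)
  have "normal_space X"
    using assms by (simp add: compact_Hausdorff_or_regular_imp_normal_space)
  moreover have "closedin X (topspace X - U)" "disjnt (topspace X - U) B"
    using U by (auto simp: disjnt_def)
  ultimately obtain u where u: "continuous_map X (top_of_set {0..1::real}) u"
    "u ` (topspace X - U) \<subseteq> {0}" "u ` B \<subseteq> {1}"
    using Urysohn_lemma[of X "topspace X - U" B 0 1] B by auto
  then have cont: "continuous_map X euclideanreal u"
    and u01: "\<And>x. x \<in> topspace X \<Longrightarrow> u x \<in> {0..1}"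
    by (auto simp: continuous_map_in_subtopology)
  have u1: "u x = 1" if "x \<in> B" for x using u(3) that by blast
  have int: "integrable M u"
    using integrable_continuous_map[OF finite_measure_axioms space_eq openin_sets assms(1) cont] .
  have "(\<integral>x. \<bar>u x - indicator B x\<bar> \<partial>M) \<le> (\<integral>x. indicator (U - B) x \<partial>M)"
  proof (rule integral_mono)
    show "integrable M (\<lambda>x. \<bar>u x - indicator B x\<bar>)"
      using B_sets by (intro integrable_abs Bochner_Integration.integrable_diff int
          integrable_real_indicator) (simp_all add: emeasure_eq_measure)
    show "integrable M (indicat_real (U - B))"
      using U openin_sets B_sets by (intro integrable_real_indicator) (auto simp: emeasure_eq_measure)
    show "\<bar>u x - indicator B x\<bar> \<le> indicat_real (U - B) x" if "x \<in> space M" for x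
      using that u01[of x] u1[of x] u(2) U by (auto simp: space_eq indicator_def)
  qed
  also have "\<dots> = measure M (U - B)"
    using openin_subset[OF U(1)] by (auto simp: space_eq intro!: arg_cong[where f = "measure M"])
  finally show thesis
    using that[OF cont u01 u1] diff by auto
qed

end

section \<open>The conditional measure as a restricted integral\<close>

text \<open>Two evaluations of one limit. For \<open>v n\<close> mapped by \<open>F\<close> to the
  approximants of the indicator, \<open>\<phi> (star A (v n) \<otimes> a)\<close> tends to the
  conditional measure by \<open>conditional_measure_LIMSEQ\<close>, and to the integral of
  \<open>F a\<close> over \<open>B\<close> by convergence in mean.\<close>

lemma (in quantum_measure_space) conditional_measure_continuous_functions:
  fixes \<mu> :: "'x measure" and X :: "'x topology"
  assumes \<mu>: "regular_borel_measure \<mu> X" and X: "compact_space X" "Hausdorff_space X"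
    and B: "closedin X B"
    and F: "F \<in> qms_hom A \<phi> (continuous_functions X) (integral_functional \<mu>)"
    and surj: "F ` carrier A = carrier (continuous_functions X)"
    and I: "I \<subseteq> carrier A" "\<And>a. a \<in> carrier A \<Longrightarrow> a \<in> I \<longleftrightarrow> (\<forall>x\<in>B. F a x = 0)"
    and a: "a \<in> carrier A" "a = (SOME a. a \<in> C)"
  shows "conditional_measure A \<phi> I C = (\<integral>x. indicator B x *\<^sub>R F a x \<partial>\<mu>)"
proof -
  let ?C = "continuous_functions X"
  interpret \<mu>: regular_borel_measure \<mu> X by fact
  interpret C: star_algebra ?C by (rule star_algebra_continuous_functions)
  have hom: "F \<in> ring_hom A ?C" and star: "\<And>a. a \<in> carrier A \<Longrightarrow> F (star A a) = star ?C (F a)"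
    and \<phi>: "\<And>a. a \<in> carrier A \<Longrightarrow> \<phi> a = integral_functional \<mu> (F a)"
    using F by (auto simp: qms_hom_def)
  interpret F: ring_hom_ring A ?C F
    by (rule ring_hom_ringI2[OF ring_axioms C.ring_axioms hom])
  have cont: "continuous_map X euclidean (F a)" if "a \<in> carrier A" for a
    using F.hom_closed[OF that] by (rule continuous_functionsD)
  note integrable = \<mu>.integrable_continuous[OF X(1)]
  note restrict = integral_functional_restrict[OF \<mu>.space_eq]
  note B_sets = \<mu>.closedin_sets[OF B]
  have B_sub: "B \<subseteq> topspace X" using closedin_subset[OF B] .
  have F_diff: "F (a \<ominus> b) = (\<lambda>x\<in>topspace X. F a x - F b x)"
    if "a \<in> carrier A" "b \<in> carrier A" for a b
    using that continuous_functions_minus[of "F a" X "F b"]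
    by (simp add: a_minus_def del: continuous_functions_simps)
  \<comment> \<open>\<open>F\<close> turns the GNS form into the square-integral inner product of
    \<open>\<mu>\<close>.\<close>
  have ip: "\<phi> (star A a \<otimes> b) = (\<integral>x. cnj (F a x) * F b x \<partial>\<mu>)"
    if "a \<in> carrier A" "b \<in> carrier A" for a b
  proof -
    have "F (star A a \<otimes> b) = (\<lambda>x\<in>topspace X. cnj (F a x) * F b x)"
      using that by (simp add: star_closed star cong: restrict_cong)
    then show ?thesis using that by (simp add: \<phi> star_closed restrict)
  qed
  have "\<exists>u. continuous_map X euclideanreal u \<and> (\<forall>x\<in>topspace X. u x \<in> {0..1}) \<and>
    (\<forall>x\<in>B. u x = 1) \<and> (\<integral>x. \<bar>u x - indicator B x\<bar> \<partial>\<mu>) \<le> inverse (Suc n)" for n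
    using \<mu>.indicator_approximation[OF X B, of "inverse (Suc n)"]
    by (metis inverse_positive_iff_positive of_nat_0_less_iff zero_less_Suc)
  then obtain u :: "nat \<Rightarrow> 'x \<Rightarrow> real" where u_cont: "\<And>n. continuous_map X euclideanreal (u n)"
    and u01: "\<And>n x. x \<in> topspace X \<Longrightarrow> u n x \<in> {0..1}" and u1: "\<And>n x. x \<in> B \<Longrightarrow> u n x = 1"
    and u_int: "\<And>n. (\<integral>x. \<bar>u n x - indicator B x\<bar> \<partial>\<mu>) \<le> inverse (Suc n)"
    by metis
  have u_diff: "integrable \<mu> (\<lambda>x. \<bar>u n x - indicator B x\<bar>)" for n
    using B_sets by (intro integrable_abs Bochner_Integration.integrable_diff integrable u_cont
        integrable_real_indicator) (simp_all add: \<mu>.emeasure_eq_measure)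
  \<comment> \<open>\<open>f\<close> is bounded by some \<open>M\<close>, so the mean error
    \<open>inverse (Suc n)\<close> of \<open>u n\<close> is multiplied by at most
    \<open>M\<close>.\<close>
  have lim: "(\<lambda>n. \<integral>x. complex_of_real (u n x) * f x \<partial>\<mu>) \<longlonglongrightarrow> (\<integral>x. indicator B x *\<^sub>R f x \<partial>\<mu>)"
    if f: "continuous_map X euclidean f" for f :: "'x \<Rightarrow> complex"
  proof -
    obtain M where M: "0 < M" "\<And>x. x \<in> topspace X \<Longrightarrow> cmod (f x) \<le> M"
      using continuous_map_bounded[OF X(1) f] by blast
    have int1: "integrable \<mu> (\<lambda>x. complex_of_real (u n x) * f x)" for n
      by (intro integrable continuous_map_mult f
          continuous_map_compose_UNIV[OF u_cont continuous_on_of_real[OF continuous_on_id]])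
    have int2: "integrable \<mu> (\<lambda>x. indicator B x *\<^sub>R f x)"
      using integrable[OF f] B_sets by (rule integrable_mult_indicator[rotated])
    have "cmod ((\<integral>x. complex_of_real (u n x) * f x \<partial>\<mu>) - (\<integral>x. indicator B x *\<^sub>R f x \<partial>\<mu>))
        \<le> M * inverse (Suc n)" for n
    proof -
      have "(\<integral>x. complex_of_real (u n x) * f x \<partial>\<mu>) - (\<integral>x. indicator B x *\<^sub>R f x \<partial>\<mu>) =
          (\<integral>x. complex_of_real (u n x) * f x - indicator B x *\<^sub>R f x \<partial>\<mu>)"
        by (rule Bochner_Integration.integral_diff[OF int1 int2, symmetric])
      also have "cmod \<dots> \<le> (\<integral>x. cmod (complex_of_real (u n x) * f x - indicator B x *\<^sub>R f x) \<partial>\<mu>)"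
        by (rule integral_norm_bound)
      also have "\<dots> \<le> (\<integral>x. M * \<bar>u n x - indicator B x\<bar> \<partial>\<mu>)"
      proof (rule integral_mono)
        fix x assume "x \<in> space \<mu>"
        have "complex_of_real (u n x) * f x - indicator B x *\<^sub>R f x =
            complex_of_real (u n x - indicator B x) * f x"
          by (simp add: algebra_simps scaleR_conv_of_real)
        then have "cmod (complex_of_real (u n x) * f x - indicator B x *\<^sub>R f x) =
            cmod (f x) * \<bar>u n x - indicator B x\<bar>"
          by (simp only: norm_mult norm_of_real mult.commute)
        also have "\<dots> \<le> M * \<bar>u n x - indicator B x\<bar>"
          using M \<open>x \<in> space \<mu>\<close> by (intro mult_right_mono) (auto simp: \<mu>.space_eq)
        finally show "cmod (complex_of_real (u n x) * f x - indicator B x *\<^sub>R f x) \<le>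
            M * \<bar>u n x - indicator B x\<bar>" .
      qed (intro integrable_norm Bochner_Integration.integrable_diff int1 int2 integrable_mult_right u_diff)+
      also have "\<dots> \<le> M * inverse (Suc n)"
        using u_int[of n] M(1) by simp
      finally show ?thesis .
    qed
    moreover have "(\<lambda>n. M * inverse (Suc n)) \<longlonglongrightarrow> 0"
      using tendsto_mult_right_zero[OF LIMSEQ_inverse_real_of_nat] by simp
    ultimately have "(\<lambda>n. (\<integral>x. complex_of_real (u n x) * f x \<partial>\<mu>) -
        (\<integral>x. indicator B x *\<^sub>R f x \<partial>\<mu>)) \<longlonglongrightarrow> 0"
      by (metis (no_types, lifting) Lim_null_comparison always_eventually)
    then show ?thesis by (rule LIM_zero_cancel)
  qed
  have u_in: "(\<lambda>x\<in>topspace X. complex_of_real (u n x)) \<in> carrier ?C" for n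
    by (intro restrict_continuous_functions
        continuous_map_compose_UNIV[OF u_cont continuous_on_of_real[OF continuous_on_id]])
  have "\<exists>b\<in>carrier A. F b = (\<lambda>x\<in>topspace X. complex_of_real (u n x))" for n
    using u_in[of n] unfolding surj[symmetric] by force
  then obtain v where v: "\<And>n. v n \<in> carrier A"
    and Fv: "\<And>n. F (v n) = (\<lambda>x\<in>topspace X. complex_of_real (u n x))"
    by metis
  have ip_v: "\<phi> (star A b \<otimes> v n) = (\<integral>x. complex_of_real (u n x) * cnj (F b x) \<partial>\<mu>)"
    "\<phi> (star A (v n) \<otimes> b) = (\<integral>x. complex_of_real (u n x) * F b x \<partial>\<mu>)"
    if "b \<in> carrier A" for b n
    using that v unfolding ip[OF that v] ip[OF v that] Fv
    by (auto intro!: Bochner_Integration.integral_cong simp: \<mu>.space_eq)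
  have "(\<lambda>n. \<phi> (star A (v n) \<otimes> a)) \<longlonglongrightarrow> conditional_measure A \<phi> I C"
  proof (rule conditional_measure_LIMSEQ[OF I(1) v _ _ _ a])
    show "\<one> \<ominus> v n \<in> I" for n
    proof -
      have "F (\<one> \<ominus> v n) x = 0" if "x \<in> B" for x
        using that B_sub u1[OF that] v ring_hom_one[OF hom]
        by (auto simp: F_diff Fv simp del: F.hom_one)
      then show ?thesis using I(2) v by simp
    qed
    show "(\<lambda>n. \<phi> (star A g \<otimes> v n)) \<longlonglongrightarrow> 0" if "g \<in> I" for g
    proof -
      have g: "g \<in> carrier A" "\<And>x. x \<in> B \<Longrightarrow> F g x = 0"
        using that I by auto
      \<comment> \<open>Orthogonality to \<open>I\<close>: in the limit only the values of
        \<open>F g\<close> on \<open>B\<close> count, and these are 0.\<close>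
      have "(\<integral>x. indicator B x *\<^sub>R cnj (F g x) \<partial>\<mu>) = (\<integral>x. 0 \<partial>\<mu>)"
        using g(2) by (intro Bochner_Integration.integral_cong) (auto simp: indicator_def)
      then show ?thesis
        using lim[OF continuous_map_cnj[OF cont[OF g(1)]]] by (simp add: ip_v g(1))
    qed
    fix e :: real assume "0 < e"
    \<comment> \<open>Two mean errors, each below half of the square of \<open>e\<close>, will bound
      the squared seminorm.\<close>
    then have "0 < e\<^sup>2 / 2" by simp
    then obtain N where N: "inverse (real (Suc N)) < e\<^sup>2 / 2"
      using reals_Archimedean by blast
    have inv: "inverse (real (Suc n)) \<le> inverse (real (Suc N))" if "N \<le> n" for n
      using that by (intro le_imp_inverse_le) simp_all
    have "gns.seminorm (v n \<ominus> v m) < e" if "N \<le> n" "N \<le> m" for n m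
    proof -
      have "complex_of_real ((gns.seminorm (v n \<ominus> v m))\<^sup>2) =
          \<phi> (star A (v n \<ominus> v m) \<otimes> (v n \<ominus> v m))"
        using gns.ip_self[of "v n \<ominus> v m"] v by simp
      also have "\<dots> = (\<integral>x. complex_of_real ((u n x - u m x)\<^sup>2) \<partial>\<mu>)"
        using v by (auto simp: ip F_diff Fv power2_eq_square \<mu>.space_eq
            intro!: Bochner_Integration.integral_cong)
      also have "\<dots> = complex_of_real (\<integral>x. (u n x - u m x)\<^sup>2 \<partial>\<mu>)"
        by (rule integral_complex_of_real)
      finally have "(gns.seminorm (v n \<ominus> v m))\<^sup>2 = (\<integral>x. (u n x - u m x)\<^sup>2 \<partial>\<mu>)"
        by (simp only: of_real_eq_iff)
      also have "\<dots> \<le> (\<integral>x. \<bar>u n x - indicator B x\<bar> + \<bar>u m x - indicator B x\<bar> \<partial>\<mu>)"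
      proof (rule integral_mono)
        show "integrable \<mu> (\<lambda>x. (u n x - u m x)\<^sup>2)"
          unfolding power2_eq_square
          by (intro integrable continuous_map_mult continuous_map_diff u_cont)
        show "integrable \<mu> (\<lambda>x. \<bar>u n x - indicator B x\<bar> + \<bar>u m x - indicator B x\<bar>)"
          by (intro Bochner_Integration.integrable_add u_diff)
        fix x assume "x \<in> space \<mu>"
        \<comment> \<open>Values in [0, 1] differ by at most 1, so squared differences are dominated
          by absolute ones: convergence in mean suffices for the Cauchy property in the GNS
          seminorm.\<close>
        then have "\<bar>u n x - u m x\<bar> \<le> 1"
          using u01[of x n] u01[of x m] by (auto simp: \<mu>.space_eq abs_le_iff)
        then have "\<bar>u n x - u m x\<bar> * \<bar>u n x - u m x\<bar> \<le> \<bar>u n x - u m x\<bar> * 1"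
          by (intro mult_left_mono) auto
        then have "(u n x - u m x)\<^sup>2 \<le> \<bar>u n x - u m x\<bar>"
          by (simp add: power2_eq_square)
        then show "(u n x - u m x)\<^sup>2 \<le> \<bar>u n x - indicator B x\<bar> + \<bar>u m x - indicator B x\<bar>"
          by linarith
      qed
      also have "\<dots> = (\<integral>x. \<bar>u n x - indicator B x\<bar> \<partial>\<mu>) + (\<integral>x. \<bar>u m x - indicator B x\<bar> \<partial>\<mu>)"
        by (intro Bochner_Integration.integral_add u_diff)
      also have "\<dots> \<le> inverse (Suc N) + inverse (Suc N)"
        by (rule add_mono[OF order_trans[OF u_int inv[OF that(1)]] order_trans[OF u_int inv[OF that(2)]]])
      also have "\<dots> < e\<^sup>2" using N by simp
      finally show ?thesis
        by (rule power2_less_imp_less[OF _ less_imp_le[OF \<open>0 < e\<close>]])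
    qed
    then show "\<exists>N. \<forall>n n'. N \<le> n \<longrightarrow> N \<le> n' \<longrightarrow> gns.seminorm (v n \<ominus> v n') < e"
      by blast
  qed
  then show ?thesis
    using lim[OF cont[OF a(1)]] by (intro LIMSEQ_unique) (simp_all add: ip_v a(1))
qed

section \<open>Transport of structure along a bijection\<close>

text \<open>Each missing law of \<open>P\<close> is checked after applying the injective
  \<open>h\<close>, where it holds in \<open>Q\<close>; positivity of \<open>\<psi>\<close> arrives
  the same way. For the quotient algebra this replaces computations with cosets and shows the
  conditional measure to be linear and positive.\<close>

lemma qms_isomorphic_transport:
  fixes P :: "('p, 'm) star_alg_scheme" and Q :: "('q, 'n) star_alg_scheme"
  assumes P: "ring P" and Q: "quantum_measure_space Q \<theta>"
    and bij: "bij_betw h (carrier P) (carrier Q)" and hom: "h \<in> ring_hom P Q"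
    and smult: "\<And>c p. p \<in> carrier P \<Longrightarrow> c \<odot>\<^bsub>P\<^esub> p \<in> carrier P"
      "\<And>c p. p \<in> carrier P \<Longrightarrow> h (c \<odot>\<^bsub>P\<^esub> p) = c \<odot>\<^bsub>Q\<^esub> h p"
    and star: "\<And>p. p \<in> carrier P \<Longrightarrow> star P p \<in> carrier P"
      "\<And>p. p \<in> carrier P \<Longrightarrow> h (star P p) = star Q (h p)"
    and \<psi>: "\<And>p. p \<in> carrier P \<Longrightarrow> \<theta> (h p) = \<psi> p"
  shows "qms_isomorphic P \<psi> Q \<theta>"
proof -
  interpret P: ring P by fact
  interpret Q: quantum_measure_space Q \<theta> by fact
  interpret h: ring_hom_ring P Q h
    by (rule ring_hom_ringI2[OF P Q.ring_axioms hom])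
  have inj: "p = p'" if "h p = h p'" "p \<in> carrier P" "p' \<in> carrier P" for p p'
    using bij that by (auto simp: bij_betw_def dest: inj_onD)
  have Q_smult: "c \<odot>\<^bsub>Q\<^esub> q \<in> carrier Q" if "q \<in> carrier Q" for c q
    using Q.smult_closed[of c q] that by simp
  have "module complex_ring P"
  proof (rule moduleI[OF cring_complex_ring P.is_abelian_group])
    fix a b :: complex and x y assume x: "x \<in> carrier P"
    show "(a \<oplus>\<^bsub>complex_ring\<^esub> b) \<odot>\<^bsub>P\<^esub> x = a \<odot>\<^bsub>P\<^esub> x \<oplus>\<^bsub>P\<^esub> b \<odot>\<^bsub>P\<^esub> x"
      using x Q.smult_l_distr[of a b "h x"] by (intro inj) (simp_all add: smult)
    show "(a \<otimes>\<^bsub>complex_ring\<^esub> b) \<odot>\<^bsub>P\<^esub> x = a \<odot>\<^bsub>P\<^esub> (b \<odot>\<^bsub>P\<^esub> x)"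
      using x Q.smult_assoc1[of a b "h x"] by (intro inj) (simp_all add: smult)
    assume y: "y \<in> carrier P"
    show "a \<odot>\<^bsub>P\<^esub> (x \<oplus>\<^bsub>P\<^esub> y) = a \<odot>\<^bsub>P\<^esub> x \<oplus>\<^bsub>P\<^esub> a \<odot>\<^bsub>P\<^esub> y"
      using x y Q.smult_r_distr[of a "h x" "h y"] by (intro inj) (simp_all add: smult)
  next
    fix x assume x: "x \<in> carrier P"
    show "\<one>\<^bsub>complex_ring\<^esub> \<odot>\<^bsub>P\<^esub> x = x"
      using x Q.smult_one[of "h x"] by (intro inj) (simp_all add: smult)
  qed (simp add: smult)
  moreover have "star_algebra_axioms P"
  proof
    fix x y c assume x: "x \<in> carrier P" and y: "y \<in> carrier P"
    show "(c \<odot>\<^bsub>P\<^esub> x) \<otimes>\<^bsub>P\<^esub> y = c \<odot>\<^bsub>P\<^esub> (x \<otimes>\<^bsub>P\<^esub> y)"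
      using x y by (intro inj) (simp_all add: smult Q.smult_mult_left)
    show "x \<otimes>\<^bsub>P\<^esub> (c \<odot>\<^bsub>P\<^esub> y) = c \<odot>\<^bsub>P\<^esub> (x \<otimes>\<^bsub>P\<^esub> y)"
      using x y by (intro inj) (simp_all add: smult Q.smult_mult_right)
    show "star P (x \<oplus>\<^bsub>P\<^esub> y) = star P x \<oplus>\<^bsub>P\<^esub> star P y"
      using x y by (intro inj) (simp_all add: star Q.star_add)
    show "star P (x \<otimes>\<^bsub>P\<^esub> y) = star P y \<otimes>\<^bsub>P\<^esub> star P x"
      using x y by (intro inj) (simp_all add: star Q.star_mult)
  next
    fix x c assume x: "x \<in> carrier P"
    show "star P x \<in> carrier P" using x by (rule star)
    show "star P (c \<odot>\<^bsub>P\<^esub> x) = cnj c \<odot>\<^bsub>P\<^esub> star P x"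
      using x by (intro inj) (simp_all add: star smult Q.star_smult)
    show "star P (star P x) = x"
      using x by (intro inj) (simp_all add: star Q.star_star)
  qed
  ultimately have P_star: "star_algebra P"
    using P by (intro star_algebra.intro)
  then have P_qms: "quantum_measure_space P \<psi>"
  proof (rule quantum_measure_space.intro, unfold_locales)
    fix x y c assume x: "x \<in> carrier P"
    show "\<psi> (c \<odot>\<^bsub>P\<^esub> x) = c * \<psi> x"
      using x by (simp add: \<psi>[symmetric] smult Q.functional_smult)
    assume y: "y \<in> carrier P"
    show "\<psi> (x \<oplus>\<^bsub>P\<^esub> y) = \<psi> x + \<psi> y"
      using x y by (simp add: \<psi>[symmetric] Q.functional_add)
  next
    fix x assume "x \<in> positive_elements P"
    then obtain a where a: "a \<in> carrier P" and x: "x = star P a \<otimes>\<^bsub>P\<^esub> a"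
      by (auto simp: positive_elements_def)
    have "h x \<in> positive_elements Q"
      using a by (auto simp: x positive_elements_def star)
    moreover have "x \<in> carrier P" using a by (simp add: x star)
    ultimately show "\<psi> x \<in> \<real>\<^sub>\<ge>\<^sub>0"
      using Q.functional_positive by (simp add: \<psi>[symmetric])
  qed
  define k where "k = inv_into (carrier P) h"
  have k: "k q \<in> carrier P" "h (k q) = q" if "q \<in> carrier Q" for q
    using bij that by (auto simp: k_def bij_betw_def inv_into_into f_inv_into_f)
  have kh: "k (h p) = p" if "p \<in> carrier P" for p
    using bij that by (simp add: k_def bij_betw_def)
  have "h \<in> qms_hom P \<psi> Q \<theta>"
    using hom smult star \<psi> by (simp add: qms_hom_def)
  moreover have "k \<in> qms_hom Q \<theta> P \<psi>"
    unfolding qms_hom_def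
  proof (intro CollectI conjI ballI allI ring_hom_memI)
    fix x y c assume x: "x \<in> carrier Q"
    show "k x \<in> carrier P" using k x by simp
    show "k (c \<odot>\<^bsub>Q\<^esub> x) = c \<odot>\<^bsub>P\<^esub> k x"
      using x by (intro inj) (simp_all add: k smult Q_smult)
    show "k (star Q x) = star P (k x)"
      using x by (intro inj) (simp_all add: k star Q.star_closed)
    show "\<psi> (k x) = \<theta> x"
      using x by (simp add: \<psi>[symmetric] k)
    assume y: "y \<in> carrier Q"
    show "k (x \<otimes>\<^bsub>Q\<^esub> y) = k x \<otimes>\<^bsub>P\<^esub> k y" "k (x \<oplus>\<^bsub>Q\<^esub> y) = k x \<oplus>\<^bsub>P\<^esub> k y"
      using x y by (intro inj; simp add: k)+
  next
    show "k \<one>\<^bsub>Q\<^esub> = \<one>\<^bsub>P\<^esub>"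
      by (intro inj) (simp_all add: k)
  qed
  ultimately show ?thesis
    using P_qms Q k kh unfolding qms_isomorphic_def by blast
qed

text \<open>\<open>quotient_star_alg A I\<close> repeats the ring fields of \<open>A Quot I\<close>
  in a larger record, so the identity is a homomorphism between the two record types and carries the
  ring laws over.\<close>

lemma ring_quotient_star_alg:
  assumes "ideal I A"
  shows "ring (quotient_star_alg A I)"
proof -
  interpret Q: ring "A Quot I" by (rule ideal.quotient_is_ring[OF assms])
  have "id \<in> ring_hom (A Quot I) (quotient_star_alg A I)"
    by (rule ring_hom_memI) (simp_all add: quotient_star_alg_def)
  from Q.ring_hom_imp_img_ring[OF this] show ?thesis
    by (simp add: quotient_star_alg_def)
qed

theorem theorem2:
  fixes A :: "'a star_alg" and nrm :: "'a \<Rightarrow> real" and \<phi> :: "'a \<Rightarrow> complex"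
    and X :: "'x topology" and \<mu> :: "'x measure" and I :: "'a set"
  assumes "commutative_c_star_measure_space A nrm \<phi>"
    and "compact_space X" and "Hausdorff_space X"
    and "regular_borel_measure \<mu> X"
    and "qms_isomorphic A \<phi> (continuous_functions X) (integral_functional \<mu>)"
    and "ideal I A" and "closedin (norm_topology A nrm) I"
  shows "\<exists>B. closedin X B \<and>
    qms_isomorphic (quotient_star_alg A I) (conditional_measure A \<phi> I)
      (continuous_functions (subtopology X B)) (integral_functional (restrict_space \<mu> B))"
proof -
  let ?C = "continuous_functions X"
  interpret A: commutative_c_star_measure_space A nrm \<phi> by fact
  interpret \<mu>: regular_borel_measure \<mu> X by fact
  interpret I: ideal I A by fact
  interpret C: star_algebra ?C by (rule star_algebra_continuous_functions)
  have I_sub: "abelian_subgroup I A"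
    by (rule abelian_subgroupI3[OF I.is_additive_subgroup A.is_abelian_group])
  interpret I: abelian_subgroup I A by fact
  obtain F G where F: "F \<in> qms_hom A \<phi> ?C (integral_functional \<mu>)"
    and G: "G \<in> qms_hom ?C (integral_functional \<mu>) A \<phi>"
    and GF: "\<And>a. a \<in> carrier A \<Longrightarrow> G (F a) = a" and FG: "\<And>f. f \<in> carrier ?C \<Longrightarrow> F (G f) = f"
    using assms(5) unfolding qms_isomorphic_def by blast
  have F_hom: "F \<in> ring_hom A ?C" and F_star: "\<And>a. a \<in> carrier A \<Longrightarrow> F (star A a) = star ?C (F a)"
    and F_smult: "\<And>c a. a \<in> carrier A \<Longrightarrow> F (c \<odot>\<^bsub>A\<^esub> a) = c \<odot>\<^bsub>?C\<^esub> F a"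
    using F by (auto simp: qms_hom_def)
  have G_hom: "G \<in> ring_hom ?C A" and G_star: "\<And>f. f \<in> carrier ?C \<Longrightarrow> G (star ?C f) = star A (G f)"
    and G_smult: "\<And>c f. f \<in> carrier ?C \<Longrightarrow> G (c \<odot>\<^bsub>?C\<^esub> f) = c \<odot>\<^bsub>A\<^esub> G f"
    using G by (auto simp: qms_hom_def)
  interpret F: ring_hom_ring A ?C F
    by (rule ring_hom_ringI2[OF A.ring_axioms C.ring_axioms F_hom])
  have surj: "F ` carrier A = carrier ?C"
    using FG ring_hom_closed[OF G_hom] F.hom_closed by (force simp: image_iff)
  \<comment> \<open>The common zeros of the functions that correspond to \<open>I\<close>. For
    \<open>I = carrier A\<close> this set is empty and \<open>C(B)\<close> is the zero
    algebra.\<close>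
  define B where "B = {x \<in> topspace X. \<forall>a\<in>I. F a x = 0}"
  have B_sub: "B \<subseteq> topspace X" by (auto simp: B_def)
  have topspace_B: "topspace (subtopology X B) = B" using B_sub by auto
  have "closedin X {x \<in> topspace X. F a x \<in> {0}}" if "a \<in> I" for a
    using that I.a_Hcarr
    by (intro closedin_continuous_map_preimage[where Y = euclidean] continuous_functionsD F.hom_closed) auto
  \<comment> \<open>Zero lies in \<open>I\<close>, so the family is nonempty and its intersection
    stays inside \<open>topspace X\<close>.\<close>
  then have "closedin X (\<Inter>a\<in>I. {x \<in> topspace X. F a x \<in> {0}})"
    using I.zero_closed by (intro closedin_INT) blast+
  also have "(\<Inter>a\<in>I. {x \<in> topspace X. F a x \<in> {0}}) = B"
    by (auto simp: B_def dest: bspec[OF _ I.zero_closed])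
  finally have B: "closedin X B" .
  have mem_I: "a \<in> I \<longleftrightarrow> (\<forall>x\<in>B. F a x = 0)" if a: "a \<in> carrier A" for a
  proof
    show "\<forall>x\<in>B. F a x = 0" if "a \<in> I" using that by (simp add: B_def)
    assume zero: "\<forall>x\<in>B. F a x = 0"
    \<comment> \<open>A common zero of all \<open>h\<close> with \<open>G h \<in> I\<close> is in
      particular one of all \<open>F b\<close> with \<open>b \<in> I\<close>, hence a point of
      \<open>B\<close>.\<close>
    have "G (F a) \<in> I"
    proof (rule A.closed_ideal_vanishing[OF G_hom G_smult G_star assms(2,6,7)])
      fix x assume x: "x \<in> topspace X"
        and h: "\<And>h. \<lbrakk>h \<in> carrier ?C; G h \<in> I\<rbrakk> \<Longrightarrow> h x = 0"
      have "F b x = 0" if "b \<in> I" for b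
        using that I.a_Hcarr[OF that] GF by (intro h) auto
      then show "F a x = 0" using x zero by (simp add: B_def)
    qed (use a in simp_all)
    then show "a \<in> I" using GF[OF a] by simp
  qed
  \<comment> \<open>Used in both directions: from right to left, restriction to \<open>B\<close> is
    independent of the representative; from left to right, it is injective on cosets.\<close>
  have F_B: "(\<forall>x\<in>B. F a x = F b x) \<longleftrightarrow> I +>\<^bsub>A\<^esub> a = I +>\<^bsub>A\<^esub> b"
    if a: "a \<in> carrier A" and b: "b \<in> carrier A" for a b
  proof -
    have "F (a \<ominus>\<^bsub>A\<^esub> b) = (\<lambda>x\<in>topspace X. F a x - F b x)"
      using a b continuous_functions_minus[of "F a" X "F b"]
      by (simp add: a_minus_def del: continuous_functions_simps)
    then have "(\<forall>x\<in>B. F a x = F b x) \<longleftrightarrow> a \<ominus>\<^bsub>A\<^esub> b \<in> I"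
      using a b B_sub by (auto simp: mem_I subset_iff)
    also have "\<dots> \<longleftrightarrow> I +>\<^bsub>A\<^esub> a = I +>\<^bsub>A\<^esub> b"
      using A.quotient_eq_iff_same_a_r_cos[OF assms(6) a b] by blast
    finally show ?thesis .
  qed
  have smult_in: "c \<odot>\<^bsub>A\<^esub> a \<in> carrier A" if "a \<in> carrier A" for a c
    using A.smult_closed[of c a] that by simp
  \<comment> \<open>\<open>ideal\<close> speaks of the ring operations only; invariance under
    scalars and star is read off from the description of \<open>I\<close> by zeros.\<close>
  have I_smult: "c \<odot>\<^bsub>A\<^esub> a \<in> I" and I_star: "star A a \<in> I" if "a \<in> I" for a c
    using that I.a_Hcarr[OF that] B_sub
    by (auto simp: mem_I smult_in A.star_closed F_smult F_star)
  let ?Q = "quotient_star_alg A I"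
  have carrier_Q: "carrier ?Q = (\<lambda>a. I +>\<^bsub>A\<^esub> a) ` carrier A"
    by (auto simp: quotient_star_alg_def FactRing_def A_RCOSETS_def')
  have some: "(SOME b. b \<in> I +>\<^bsub>A\<^esub> a) \<in> carrier A" "I +>\<^bsub>A\<^esub> (SOME b. b \<in> I +>\<^bsub>A\<^esub> a) = I +>\<^bsub>A\<^esub> a"
    if "a \<in> carrier A" for a
  proof -
    have *: "(SOME b. b \<in> I +>\<^bsub>A\<^esub> a) \<in> I +>\<^bsub>A\<^esub> a"
      unfolding some_in_eq using I.a_rcos_self[OF that] by blast
    show "(SOME b. b \<in> I +>\<^bsub>A\<^esub> a) \<in> carrier A"
      using I.a_elemrcos_carrier[OF that *] .
    show "I +>\<^bsub>A\<^esub> (SOME b. b \<in> I +>\<^bsub>A\<^esub> a) = I +>\<^bsub>A\<^esub> a"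
      using I.a_repr_independence'[OF * that] by simp
  qed
  \<comment> \<open>The same \<open>SOME\<close> representative as in
    \<open>conditional_measure\<close>, so the two functionals are compared on one and the same
    function.\<close>
  define h where "h c = restrict (F (SOME a. a \<in> c)) B" for c
  have h: "h (I +>\<^bsub>A\<^esub> a) = restrict (F a) B" if "a \<in> carrier A" for a
    unfolding h_def using F_B[OF some(1)[OF that] that] some(2)[OF that] by (auto intro!: restrict_ext)
  have F_restrict: "restrict (F a) B \<in> carrier (continuous_functions (subtopology X B))"
    if "a \<in> carrier A" for a
  proof -
    have "continuous_map (subtopology X B) euclidean (F a)"
      using that by (intro continuous_map_from_subtopology continuous_functionsD F.hom_closed)
    from restrict_continuous_functions[OF this] show ?thesis
      unfolding topspace_B .
  qed
  have "qms_isomorphic ?Q (conditional_measure A \<phi> I)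
      (continuous_functions (subtopology X B)) (integral_functional (restrict_space \<mu> B))"
  proof (rule qms_isomorphic_transport[where h = h])
    show "ring ?Q"
      by (rule ring_quotient_star_alg[OF assms(6)])
    have space_B: "space (restrict_space \<mu> B) = topspace (subtopology X B)"
      using B_sub by (auto simp: space_restrict_space \<mu>.space_eq)
    show "quantum_measure_space (continuous_functions (subtopology X B))
        (integral_functional (restrict_space \<mu> B))"
    proof (rule quantum_measure_space_continuous_functions)
      show "finite_measure (restrict_space \<mu> B)"
        using \<mu>.closedin_sets[OF B] by (intro finite_measure_restrict_space \<mu>.finite_measure_axioms) simp
      show "space (restrict_space \<mu> B) = topspace (subtopology X B)" by (rule space_B)
      show "U \<in> sets (restrict_space \<mu> B)" if "openin (subtopology X B) U" for U
        using that \<mu>.openin_sets by (auto simp: sets_restrict_space openin_subtopology)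
      show "compact_space (subtopology X B)"
        using closedin_compact_space[OF assms(2) B] by (rule compact_space_subtopology)
    qed
    show "bij_betw h (carrier ?Q) (carrier (continuous_functions (subtopology X B)))"
    proof (rule bij_betw_imageI)
      show "inj_on h (carrier ?Q)"
      proof (rule inj_onI)
        fix p q assume "p \<in> carrier ?Q" "q \<in> carrier ?Q" and eq: "h p = h q"
        then obtain a b where ab: "a \<in> carrier A" "b \<in> carrier A"
          and pq: "p = I +>\<^bsub>A\<^esub> a" "q = I +>\<^bsub>A\<^esub> b"
          by (auto simp: carrier_Q)
        then have "restrict (F a) B = restrict (F b) B" using eq by (simp add: h)
        then show "p = q" using F_B[OF ab] unfolding pq by (metis restrict_apply')
      qed
      show "h ` carrier ?Q = carrier (continuous_functions (subtopology X B))"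
      proof
        show "h ` carrier ?Q \<subseteq> carrier (continuous_functions (subtopology X B))"
          by (auto simp: carrier_Q h F_restrict)
        show "carrier (continuous_functions (subtopology X B)) \<subseteq> h ` carrier ?Q"
        proof
          fix f assume "f \<in> carrier (continuous_functions (subtopology X B))"
          moreover have "normal_space X"
            using assms by (simp add: compact_Hausdorff_or_regular_imp_normal_space)
          ultimately obtain g where g: "g \<in> carrier ?C" "restrict g B = f"
            using continuous_functions_extension[OF _ B] by blast
          then obtain a where a: "a \<in> carrier A" "F a = g"
            using surj by (metis imageE)
          then have "h (I +>\<^bsub>A\<^esub> a) = f" using g(2) by (simp add: h)
          then show "f \<in> h ` carrier ?Q" using a(1) by (auto simp: carrier_Q)
        qed
      qed
    qed
    show "h \<in> ring_hom ?Q (continuous_functions (subtopology X B))"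
    proof (rule ring_hom_memI)
      fix p q assume "p \<in> carrier ?Q" "q \<in> carrier ?Q"
      then obtain a b where ab: "a \<in> carrier A" "b \<in> carrier A"
        and pq: "p = I +>\<^bsub>A\<^esub> a" "q = I +>\<^bsub>A\<^esub> b"
        by (auto simp: carrier_Q)
      have "p \<otimes>\<^bsub>?Q\<^esub> q = I +>\<^bsub>A\<^esub> (a \<otimes>\<^bsub>A\<^esub> b)" "p \<oplus>\<^bsub>?Q\<^esub> q = I +>\<^bsub>A\<^esub> (a \<oplus>\<^bsub>A\<^esub> b)"
        using ab by (simp_all add: pq quotient_star_alg_def FactRing_def I.rcoset_mult_add I.a_rcos_sum)
      then show "h (p \<otimes>\<^bsub>?Q\<^esub> q) = h p \<otimes>\<^bsub>continuous_functions (subtopology X B)\<^esub> h q"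
        "h (p \<oplus>\<^bsub>?Q\<^esub> q) = h p \<oplus>\<^bsub>continuous_functions (subtopology X B)\<^esub> h q"
        using ab B_sub by (auto simp: pq h topspace_B intro!: restrict_ext)
    next
      show "h p \<in> carrier (continuous_functions (subtopology X B))" if "p \<in> carrier ?Q" for p
        using that by (auto simp: carrier_Q h F_restrict)
      have "\<one>\<^bsub>?Q\<^esub> = I +>\<^bsub>A\<^esub> \<one>\<^bsub>A\<^esub>"
        by (simp add: quotient_star_alg_def FactRing_def)
      then show "h \<one>\<^bsub>?Q\<^esub> = \<one>\<^bsub>continuous_functions (subtopology X B)\<^esub>"
        using B_sub by (auto simp: h topspace_B intro!: restrict_ext)
    qed
    fix p c assume "p \<in> carrier ?Q"
    then obtain a where a: "a \<in> carrier A" and p: "p = I +>\<^bsub>A\<^esub> a"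
      by (auto simp: carrier_Q)
    have smult: "c \<odot>\<^bsub>?Q\<^esub> p = I +>\<^bsub>A\<^esub> (c \<odot>\<^bsub>A\<^esub> a)"
      using a A.coset_smult_rcos[OF I_sub I_smult] by (simp add: p quotient_star_alg_def)
    have star: "star ?Q p = I +>\<^bsub>A\<^esub> star A a"
      using a A.coset_star_rcos[OF I_sub I_star] by (simp add: p quotient_star_alg_def)
    show "c \<odot>\<^bsub>?Q\<^esub> p \<in> carrier ?Q" "star ?Q p \<in> carrier ?Q"
      unfolding smult star using a by (auto simp: carrier_Q smult_in A.star_closed)
    show "h (c \<odot>\<^bsub>?Q\<^esub> p) = c \<odot>\<^bsub>continuous_functions (subtopology X B)\<^esub> h p"
      "h (star ?Q p) = star (continuous_functions (subtopology X B)) (h p)"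
      unfolding smult star using a B_sub
      by (auto simp: p h topspace_B smult_in A.star_closed F_smult F_star intro!: restrict_ext)
    \<comment> \<open>Both functionals become the integral over \<open>B\<close> of the function of
      the chosen representative.\<close>
    have "integral_functional (restrict_space \<mu> B) (h p) =
        (\<integral>x. F (SOME a. a \<in> p) x \<partial>restrict_space \<mu> B)"
      using integral_functional_restrict[OF space_B] unfolding h_def topspace_B by blast
    also have "\<dots> = (\<integral>x. indicator B x *\<^sub>R F (SOME a. a \<in> p) x \<partial>\<mu>)"
      using \<mu>.closedin_sets[OF B] by (intro integral_restrict_space) simp
    also have "\<dots> = conditional_measure A \<phi> I p"
      using some(1)[OF a] I.a_subset mem_I
      by (intro A.conditional_measure_continuous_functions[OF assms(4,2,3) B F surj, symmetric])
        (auto simp: p)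
    finally show "integral_functional (restrict_space \<mu> B) (h p) = conditional_measure A \<phi> I p" .
  qed
  with B show ?thesis by blast
qed

end
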